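(* Let $p$ be a prime number. Then, for every positive integer $h$ such that $\gcd(h,p)=1$, the arithmetic progression $\mathbf{A}(h,p)=\{pm+h : m\in\mathbf{N}\cup\{0\}\}$ contains infinitely many prime numbers.
   Context: $\mathbf{N}$ denotes the set of positive integers. For integers $h$ and $k>0$, $\mathbf{A}(h,k):=k(\mathbf{N}\cup\{0\})+h=\{km+h : m\in\mathbf{N}\cup\{0\}\}$. *)

theory Defs
  imports "HOL-Computational_Algebra.Primes"
begin

definition arith_prog :: "int \<Rightarrow> int \<Rightarrow> int set" where
  "arith_prog h k = {k * int m + h | m :: nat. True}"

end

theory Submission
  imports Defs "HOL-Number_Theory.Prime_Powers" "HOL-Number_Theory.Residue_Primitive_Roots"
    "HOL-Analysis.Summation_Tests" "HOL-Computational_Algebra.Squarefree"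
begin

text \<open>
  The argument follows Mertens. For a character \<open>\<psi>\<close> modulo \<open>p\<close> put \<open>S N = (\<Sum>n\<le>N. \<psi> n * \<Lambda> n / n)\<close> and
  \<open>L = (\<Sum>n. \<psi> n / n)\<close>. If \<open>\<psi>\<close> is trivial, then \<open>S N = ln N + O(1)\<close>. If \<open>\<psi>\<close> is nontrivial, its partial
  sums are bounded; summing \<open>\<psi> n * ln n / n\<close> with \<open>ln = 1 * \<Lambda>\<close> shows that \<open>S\<close> is bounded when
  \<open>L \<noteq> 0\<close>, while Moebius inversion gives \<open>S N = - ln N + O(1)\<close> when \<open>L = 0\<close>. Summed over all
  characters, \<open>S N\<close> has nonnegative real part, so \<open>L = 0\<close> for at most one \<open>\<psi>\<close>; as \<open>L\<close> also vanishes
  for the conjugate character, this \<open>\<psi>\<close> would have to be real. Real characters are excluded by Monsky's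
  argument: \<open>1 * \<psi>\<close> is nonnegative and at least 1 at squares, so \<open>\<Sum>n. (1 * \<psi>) n * t ^ n\<close> is unbounded
  as \<open>t \<rightarrow> 1\<close>, whereas \<open>L = 0\<close> bounds this Lambert series. Orthogonality then shows that
  \<open>\<Lambda> n / n\<close> has a divergent sum over every residue class prime to \<open>p\<close>.
\<close>

section \<open>Sums over divisors and partial summation\<close>

lemma real_div_nat_le: "real (N div d) \<le> real N / real d"
proof (cases "d = 0")
  case False
  have "real (d * (N div d)) \<le> real N"
    by (subst of_nat_le_iff) simp
  then show ?thesis using False by (simp add: field_simps)
qed simp

lemma real_div_nat_gt: "d > 0 \<Longrightarrow> real N / real d < real (N div d + 1)"
proof -
  assume d: "d > 0"
  have "real N < real (d * (N div d + 1))"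
    using d by (subst of_nat_less_iff) (simp add: dividend_less_times_div)
  then show ?thesis using d by (simp add: field_simps)
qed


text \<open>Abel summation. A block of \<open>a\<close> starting after \<open>M\<close> is a
  difference of two partial sums, hence the factor 2; the decrements of \<open>f\<close> telescope,
  so only its first value \<open>f (Suc M)\<close> remains, uniformly in \<open>N\<close>.\<close>

lemma norm_sum_mult_antimono_le:
  fixes a :: "nat \<Rightarrow> 'a::real_normed_field" and f :: "nat \<Rightarrow> real"
  assumes bnd: "\<And>n. norm (\<Sum>i=1..n. a i) \<le> B"
    and anti: "\<And>n. M < n \<Longrightarrow> f (Suc n) \<le> f n" and nonneg: "\<And>n. M < n \<Longrightarrow> f n \<ge> 0"
  shows "norm (\<Sum>n=Suc M..N. a n * of_real (f n)) \<le> 2 * B * f (Suc M)"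
proof -
  define Q where "Q n = (\<Sum>i=1..n. a i) - (\<Sum>i=1..M. a i)" for n
  have B: "B \<ge> 0"
    using norm_ge_zero bnd[of 0] by (rule order_trans)
  have Q: "norm (Q n) \<le> 2 * B" for n
    unfolding Q_def using norm_triangle_ineq4[of "\<Sum>i=1..n. a i" "\<Sum>i=1..M. a i"] bnd[of n] bnd[of M]
    by linarith
  \<comment> \<open>With the boundary term \<open>Q N * f N\<close> removed, passing from
    \<open>N\<close> to \<open>Suc N\<close> adds only \<open>Q N * (f N - f (Suc N))\<close>, and
    the bounds telescope.\<close>
  have partial: "norm ((\<Sum>n=Suc M..N. a n * of_real (f n)) - Q N * of_real (f N))
      \<le> 2 * B * (f (Suc M) - f N)" if "Suc M \<le> N" for N
    using that
  proof (induction N rule: dec_induct)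
    case base
    then show ?case by (simp add: Q_def)
  next
    case (step N)
    have "(\<Sum>n=Suc M..Suc N. a n * of_real (f n)) - Q (Suc N) * of_real (f (Suc N))
      = ((\<Sum>n=Suc M..N. a n * of_real (f n)) - Q N * of_real (f N)) + Q N * of_real (f N - f (Suc N))"
      using step.hyps by (simp add: Q_def algebra_simps)
    also have "norm \<dots> \<le> 2 * B * (f (Suc M) - f N) + 2 * B * (f N - f (Suc N))"
    proof (rule norm_triangle_mono[OF step.IH])
      have "norm (Q N * of_real (f N - f (Suc N))) = norm (Q N) * (f N - f (Suc N))"
        using anti[of N] step.hyps by (simp only: norm_mult norm_of_real) simp
      also have "\<dots> \<le> 2 * B * (f N - f (Suc N))"
        using anti[of N] step.hyps Q by (intro mult_right_mono) auto
      finally show "norm (Q N * of_real (f N - f (Suc N))) \<le> 2 * B * (f N - f (Suc N))" .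
    qed
    finally show ?case by (simp add: algebra_simps)
  qed
  show ?thesis
  proof (cases "Suc M \<le> N")
    case True
    have "norm (\<Sum>n=Suc M..N. a n * of_real (f n))
       = norm (((\<Sum>n=Suc M..N. a n * of_real (f n)) - Q N * of_real (f N)) + Q N * of_real (f N))"
      by simp
    also have "\<dots> \<le> 2 * B * (f (Suc M) - f N) + 2 * B * f N"
    proof (rule norm_triangle_mono[OF partial[OF True]])
      show "norm (Q N * of_real (f N)) \<le> 2 * B * f N"
        using nonneg[of N] Q[of N] True by (simp add: norm_mult mult_right_mono)
    qed
    finally show ?thesis by (simp add: algebra_simps)
  next
    case False
    then show ?thesis using B nonneg[of "Suc M"] by simp
  qed
qed

text \<open>Put \<open>n = d * m\<close>: pairs of \<open>n \<le> N\<close> and a divisor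
  \<open>d\<close> correspond to pairs with \<open>d * m \<le> N\<close>. Every Dirichlet
  convolution below is summed through this identity.\<close>

lemma sum_divisors_swap:
  fixes F :: "nat \<Rightarrow> nat \<Rightarrow> 'a::comm_monoid_add"
  shows "(\<Sum>n=1..N. \<Sum>d | d dvd n. F d (n div d)) = (\<Sum>d=1..N. \<Sum>m=1..N div d. F d m)"
proof -
  have "(\<Sum>n=1..N. \<Sum>d | d dvd n. F d (n div d))
      = (\<Sum>(n,d)\<in>(SIGMA n:{1..N}. {d. d dvd n}). F d (n div d))"
    by (rule sum.Sigma) auto
  also have "\<dots> = (\<Sum>(d,m)\<in>(SIGMA d:{1..N}. {1..N div d}). F d m)"
  proof (rule sum.reindex_bij_witness[where j = "\<lambda>(n,d). (d, n div d)" and i = "\<lambda>(d,m). (d * m, d)"],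
      goal_cases)
    case (2 x)
    then obtain d k where x: "x = (d * k, d)" "d * k \<in> {1..N}"
      by (auto elim!: dvdE)
    then have "d > 0" "k > 0"
      by (auto intro!: Nat.gr0I)
    moreover have "d \<le> N"
      using order_trans[of d "d * k" N] x \<open>k > 0\<close> by simp
    ultimately show ?case
      using x by (auto simp: less_eq_div_iff_mult_less_eq mult.commute[of k])
  next
    case (4 x)
    then show ?case
      by (auto simp: Suc_le_eq less_eq_div_iff_mult_less_eq mult.commute)
  qed auto
  also have "\<dots> = (\<Sum>d=1..N. \<Sum>m=1..N div d. F d m)"
    by (rule sum.Sigma [symmetric]) auto
  finally show ?thesis .
qed

section \<open>Estimates of Chebyshev and Mertens\<close>

lemma sum_ln_eq_ln_fact: "(\<Sum>n=1..N. ln (real n)) = ln (fact N)"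
  by (induction N) (auto simp: ln_mult)

text \<open>The weak half of Stirling's formula; the induction step rests on
  \<open>n * ln (1 + 1 / n) \<le> 1\<close>.\<close>

lemma ln_fact_ge: "N \<ge> 1 \<Longrightarrow> ln (fact N) \<ge> real N * ln (real N) - real N"
proof (induction N rule: nat_induct_at_least)
  case (Suc n)
  have "real n * (ln (real (Suc n)) - ln (real n)) = real n * ln (1 + 1 / real n)"
  proof -
    have "1 + 1 / real n = real (Suc n) / real n"
      using Suc.hyps by (simp add: field_simps)
    then show ?thesis using Suc.hyps by (simp only: ln_div) simp
  qed
  also have "\<dots> \<le> real n * (1 / real n)"
    by (intro mult_left_mono ln_add_one_self_le_self) auto
  finally have "real n * (ln (real (Suc n)) - ln (real n)) \<le> 1"
    using Suc.hyps by simp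
  moreover have "ln (fact (Suc n)) = ln (real (Suc n)) + ln (fact n)"
    by (subst fact_Suc, subst ln_mult) auto
  ultimately show ?case using Suc.IH by (simp add: algebra_simps del: fact_Suc)
qed auto

lemma ln_fact_le: "ln (fact N) \<le> real N * ln (real N)"
proof -
  have "(\<Sum>n=1..N. ln (real n)) \<le> (\<Sum>n=1..N. ln (real N))"
    by (intro sum_mono) auto
  then show ?thesis using sum_ln_eq_ln_fact[of N] by simp
qed

text \<open>Legendre's formula: split each \<open>ln n\<close> as the sum of
  \<open>mangoldt d\<close> over its divisors; then \<open>N div d\<close> counts the multiples of
  \<open>d\<close> up to \<open>N\<close>.\<close>

lemma ln_fact_eq_sum_mangoldt:
  "ln (fact N) = (\<Sum>d=1..N. mangoldt d * real (N div d))"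
proof -
  have "ln (fact N) = (\<Sum>n=1..N. \<Sum>d | d dvd n. mangoldt d :: real)"
    unfolding sum_ln_eq_ln_fact [symmetric] by (intro sum.cong) (auto simp: mangoldt_sum)
  also have "\<dots> = (\<Sum>d=1..N. mangoldt d * real (N div d))"
    by (subst sum_divisors_swap) (simp add: mult.commute)
  finally show ?thesis .
qed

lemma central_binomial_le: "(2 * N) choose N \<le> 2 ^ (2 * N)"
proof -
  have "(2 * N) choose N \<le> (\<Sum>k\<le>2*N. (2 * N) choose k)"
    by (rule member_le_sum) auto
  then show ?thesis by (simp add: choose_row_sum)
qed

text \<open>Chebyshev's argument. By Legendre's formula the logarithm of the central binomial
  coefficient weights \<open>mangoldt d\<close> by \<open>2 * N div d - 2 * (N div d)\<close>, which
  is never negative and at least 1 for \<open>N < d \<le> 2 * N\<close>; the coefficient itself is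
  at most \<open>4 ^ N\<close>.\<close>

lemma sum_mangoldt_dyadic: "(\<Sum>d=N+1..2*N. mangoldt d :: real) \<le> 2 * ln 2 * real N"
proof -
  have "(\<Sum>d=N+1..2*N. mangoldt d :: real)
      \<le> (\<Sum>d=1..2*N. mangoldt d * (real (2 * N div d) - 2 * real (N div d)))"
  proof (rule order_trans[OF _ sum_mono2])
    show "(\<Sum>d=N+1..2*N. mangoldt d :: real)
       \<le> (\<Sum>d=N+1..2*N. mangoldt d * (real (2 * N div d) - 2 * real (N div d)))"
    proof (intro sum_mono)
      fix d assume d: "d \<in> {N+1..2*N}"
      have "N div d = 0" "2 * N div d \<ge> 1"
        using d by (auto simp: Suc_le_eq div_greater_zero_iff)
      then show "(mangoldt d :: real) \<le> mangoldt d * (real (2 * N div d) - 2 * real (N div d))"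
        using mangoldt_nonneg[of d] mult_left_mono[of 1 "real (2 * N div d)" "mangoldt d"] by simp
    qed
    fix d
    have "2 * (N div d) \<le> 2 * N div d"
      by (cases "d = 0") (auto simp: less_eq_div_iff_mult_less_eq)
    then have "2 * real (N div d) \<le> real (2 * N div d)"
      by linarith
    then show "0 \<le> mangoldt d * (real (2 * N div d) - 2 * real (N div d))"
      by (intro mult_nonneg_nonneg mangoldt_nonneg) simp
  qed auto
  also have "\<dots> = ln (fact (2 * N)) - 2 * (\<Sum>d=1..2*N. mangoldt d * real (N div d))"
    by (simp add: ln_fact_eq_sum_mangoldt algebra_simps sum_subtractf sum_distrib_left)
  \<comment> \<open>The terms with \<open>d > N\<close> vanish, because then
    \<open>N div d = 0\<close>.\<close>
  also have "(\<Sum>d=1..2*N. mangoldt d * real (N div d)) = ln (fact N)"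
    unfolding ln_fact_eq_sum_mangoldt by (rule sum.mono_neutral_right) auto
  also have "ln (fact (2 * N)) - 2 * ln (fact N) = ln (real ((2 * N) choose N))"
    by (simp add: binomial_fact ln_div ln_mult mult_2 [symmetric])
  also have "\<dots> \<le> ln (real (2 ^ (2 * N)))"
    using central_binomial_le[of N] by (subst ln_le_cancel_iff) (auto simp del: of_nat_power)
  also have "\<dots> = 2 * ln 2 * real N"
    by (simp add: ln_realpow)
  finally show ?thesis .
qed

text \<open>Repeated halving: the dyadic bound turns \<open>4 * M\<close> for the lower half into at
  most \<open>6 * M\<close> up to \<open>2 * M\<close>. The slack up to \<open>8 * M\<close> absorbs
  the extra term of an odd \<open>N\<close>, which is at most \<open>2 * M\<close>.\<close>

lemma sum_mangoldt_le: "(\<Sum>d=1..N. mangoldt d :: real) \<le> 4 * real N"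
proof (induction N rule: less_induct)
  case (less N)
  define M where "M = N div 2"
  show ?case
  proof (cases "N = 0")
    case False
    have M: "M < N" and N: "N = 2 * M \<or> N = Suc (2 * M)"
      using False by (auto simp: M_def)
    have "(\<Sum>d=1..2*M. mangoldt d :: real) = (\<Sum>d=1..M. mangoldt d) + (\<Sum>d=M+1..2*M. mangoldt d)"
      using sum.ub_add_nat[of 1 M "mangoldt :: nat \<Rightarrow> real" M] by (simp add: mult_2)
    also have "\<dots> \<le> 4 * real M + 2 * ln 2 * real M"
      using less.IH[OF M] sum_mangoldt_dyadic[of M] by linarith
    also have "\<dots> \<le> 6 * real M"
      using ln_le_minus_one[of 2] mult_right_mono[of "ln 2" 1 "real M"] by simp
    finally have even: "(\<Sum>d=1..2*M. mangoldt d :: real) \<le> 6 * real M" .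
    from N show ?thesis
    proof
      assume "N = Suc (2 * M)"
      moreover have "mangoldt (Suc (2 * M)) \<le> real (2 * M)"
        using mangoldt_le[of "Suc (2 * M)"] ln_le_minus_one[of "real (Suc (2 * M))"] by simp
      ultimately show ?thesis using even by simp
    qed (use even in simp)
  qed simp
qed

text \<open>In Legendre's formula, replacing \<open>N div d\<close> by \<open>N / d - 1\<close>
  costs the sum of \<open>mangoldt\<close>, which Chebyshev's bound keeps below
  \<open>4 * N\<close>; then divide by \<open>N\<close>.\<close>

lemma sum_mangoldt_over_le:
  "N \<ge> 1 \<Longrightarrow> (\<Sum>d=1..N. mangoldt d / real d) \<le> ln (real N) + 4"
proof -
  assume N: "N \<ge> 1"
  have "real N * (\<Sum>d=1..N. mangoldt d / real d) - (\<Sum>d=1..N. mangoldt d)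
      = (\<Sum>d=1..N. mangoldt d * (real N / real d - 1))"
    by (simp add: sum_distrib_left sum_subtractf algebra_simps)
  also have "\<dots> \<le> (\<Sum>d=1..N. mangoldt d * real (N div d))"
  proof (intro sum_mono mult_left_mono mangoldt_nonneg)
    fix d assume "d \<in> {1..N}"
    then show "real N / real d - 1 \<le> real (N div d)"
      using real_div_nat_gt[of d N] by simp
  qed
  also have "\<dots> \<le> real N * ln (real N)"
    using ln_fact_le[of N] by (simp add: ln_fact_eq_sum_mangoldt)
  finally have "real N * (\<Sum>d=1..N. mangoldt d / real d) \<le> real N * (ln (real N) + 4)"
    using sum_mangoldt_le[of N] by (simp add: algebra_simps)
  then show ?thesis using N by simp
qed

lemma sum_mangoldt_over_ge:
  "N \<ge> 1 \<Longrightarrow> (\<Sum>d=1..N. mangoldt d / real d) \<ge> ln (real N) - 1"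
proof -
  assume N: "N \<ge> 1"
  have "real N * (ln (real N) - 1) \<le> (\<Sum>d=1..N. mangoldt d * real (N div d))"
    using ln_fact_ge[OF N] by (simp add: ln_fact_eq_sum_mangoldt algebra_simps)
  also have "\<dots> \<le> (\<Sum>d=1..N. mangoldt d * (real N / real d))"
    by (intro sum_mono mult_left_mono mangoldt_nonneg real_div_nat_le)
  also have "\<dots> = real N * (\<Sum>d=1..N. mangoldt d / real d)"
    by (simp add: sum_distrib_left mult_ac)
  finally show ?thesis using N by simp
qed

text \<open>Only prime powers \<open>q ^ k\<close> with \<open>k \<ge> 2\<close> contribute. For
  each \<open>q\<close> they form a geometric series of size about \<open>ln q / q ^ 2\<close>, and
  these are summable.\<close>

lemma sum_mangoldt_nonprime_bounded:
  "\<exists>C. \<forall>N. (\<Sum>d\<in>{d\<in>{1..N}. \<not> prime d}. mangoldt d / real d) \<le> C"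
proof -
  have summ: "summable (\<lambda>q. 4 * (1 / real q powr (3/2)))"
    by (intro summable_mult) (simp add: summable_real_powr_iff flip: powr_minus_divide)
  show ?thesis
  proof (intro exI allI)
    fix N :: nat
    let ?P = "{q. prime q \<and> q \<le> N}"
    have "(\<Sum>d\<in>{d\<in>{1..N}. \<not> prime d}. mangoldt d / real d)
        = (\<Sum>d | d \<in> {1..N} \<and> \<not> prime d \<and> primepow d. mangoldt d / real d)"
      by (intro sum.mono_neutral_right) (auto simp: mangoldt_def)
    also have "\<dots> \<le> (\<Sum>d\<in>(\<lambda>(q,k). q ^ k) ` (?P \<times> {2..N}). mangoldt d / real d)"
    proof (intro sum_mono2)
      show "{d\<in>{1..N}. \<not> prime d \<and> primepow d} \<subseteq> (\<lambda>(q,k). q ^ k) ` (?P \<times> {2..N})"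
      proof safe
        fix d assume d: "d \<in> {1..N}" "\<not> prime d" "primepow d"
        then obtain q k where qk: "prime q" "k > 0" "d = q ^ k"
          by (auto simp: primepow_def)
        have "k \<noteq> 1" using qk d by auto
        moreover have "q \<le> d" using qk self_le_power[of q k] prime_ge_1_nat[of q] by simp
        moreover have "k \<le> d"
          using qk power_mono[of 2 q k] less_exp[of k] prime_ge_2_nat[of q] by simp
        ultimately show "d \<in> (\<lambda>(q,k). q ^ k) ` (?P \<times> {2..N})"
          using qk d by (intro image_eqI[of _ _ "(q,k)"]) auto
      qed
    qed (auto intro!: divide_nonneg_nonneg mangoldt_nonneg)
    also have "\<dots> \<le> (\<Sum>(q,k)\<in>?P \<times> {2..N}. mangoldt (q ^ k) / real (q ^ k))"
    proof -
      have "(\<Sum>d\<in>(\<lambda>(q,k). q ^ k) ` (?P \<times> {2..N}). mangoldt d / real d)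
          \<le> sum ((\<lambda>d. mangoldt d / real d) \<circ> (\<lambda>(q,k). q ^ k)) (?P \<times> {2..N})"
        by (intro sum_image_le) (auto simp: mangoldt_nonneg)
      then show ?thesis by (simp add: o_def case_prod_unfold)
    qed
    also have "\<dots> = (\<Sum>q\<in>?P. \<Sum>k=2..N. mangoldt (q ^ k) / real (q ^ k))"
      by (rule sum.Sigma [symmetric]) auto
    also have "\<dots> \<le> (\<Sum>q\<in>?P. 4 * (1 / real q powr (3/2)))"
    proof (intro sum_mono)
      fix q assume "q \<in> ?P"
      then have q: "prime q" and q2: "real q \<ge> 2" by (auto dest: prime_ge_2_nat)
      have "(\<Sum>k=2..N. mangoldt (q ^ k) / real (q ^ k)) = ln (real q) * (\<Sum>k=2..N. (1 / real q) ^ k)"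
        using q by (simp add: sum_distrib_left power_one_over)
      \<comment> \<open>Since \<open>q \<ge> 2\<close>, the denominator \<open>1 - 1 / q\<close> of
        the geometric sum is at least 1/2.\<close>
      also have "(\<Sum>k=2..N. (1 / real q) ^ k) \<le> 2 / real q ^ 2"
      proof (cases "N \<ge> 2")
        case True
        have "(\<Sum>k=2..N. (1 / real q) ^ k) = ((1 / real q) ^ 2 - (1 / real q) ^ Suc N) / (1 - 1 / real q)"
          using q2 True by (subst sum_gp) auto
        also have "\<dots> \<le> (1 / real q) ^ 2 / (1 / 2)"
          using q2 by (intro frac_le) (auto simp: field_simps)
        finally show ?thesis by (simp add: power_one_over)
      qed auto
      \<comment> \<open>Apply \<open>ln x \<le> x - 1\<close> to the square root of
        \<open>q\<close>; this leaves the convergent exponent 3/2.\<close>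
      also have "ln (real q) * (2 / real q ^ 2) \<le> (2 * real q powr (1/2)) * (2 / real q ^ 2)"
      proof (intro mult_right_mono)
        have "ln (real q) = 2 * ln (real q powr (1/2))"
          using q2 by (simp add: ln_powr)
        also have "\<dots> \<le> 2 * real q powr (1/2)"
          using ln_le_minus_one[of "real q powr (1/2)"] q2 by simp
        finally show "ln (real q) \<le> 2 * real q powr (1/2)" .
      qed auto
      also have "\<dots> = 4 * (1 / real q powr (3/2))"
      proof -
        have "real q ^ 2 = real q powr (1/2) * real q powr (3/2)"
          using q2 by (simp add: powr_add [symmetric])
        then show ?thesis
          using q2 by simp
      qed
      finally show "(\<Sum>k=2..N. mangoldt (q ^ k) / real (q ^ k)) \<le> 4 * (1 / real q powr (3/2))"
        using q2 by (simp add: mult_left_mono)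
    qed
    also have "\<dots> \<le> (\<Sum>q. 4 * (1 / real q powr (3/2)))"
      by (intro sum_le_suminf summ) auto
    finally show "(\<Sum>d\<in>{d\<in>{1..N}. \<not> prime d}. mangoldt d / real d) \<le> (\<Sum>q. 4 * (1 / real q powr (3/2)))" .
  qed
qed

section \<open>The Moebius function and real characters\<close>

text \<open>A divisor of \<open>q ^ k * m\<close> is \<open>q ^ j * e\<close> in exactly one way:
  \<open>j\<close> is recovered as the multiplicity of \<open>q\<close>, since \<open>q\<close> does
  not divide \<open>e\<close>.\<close>

lemma sum_divisors_prime_power_mult:
  fixes F :: "nat \<Rightarrow> 'a::comm_monoid_add"
  assumes q: "prime q" and m: "m > 0" "\<not> q dvd m"
  shows "(\<Sum>d | d dvd q ^ k * m. F d) = (\<Sum>j\<le>k. \<Sum>e | e dvd m. F (q ^ j * e))"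
proof -
  have mult: "multiplicity q (q ^ j * e) = j" if "e dvd m" for j e
  proof -
    have "\<not> q dvd e" using that m dvd_trans by blast
    moreover have "e \<noteq> 0" using that m by auto
    ultimately show ?thesis using q
      by (subst prime_elem_multiplicity_mult_distrib)
        (auto simp: not_dvd_imp_multiplicity_0)
  qed
  have "(\<Sum>d | d dvd q ^ k * m. F d) = (\<Sum>(j,e)\<in>{..k} \<times> {e. e dvd m}. F (q ^ j * e))"
  proof (rule sum.reindex_cong)
    show "inj_on (\<lambda>(j,e). q ^ j * e) ({..k} \<times> {e. e dvd m})"
    proof (rule inj_onI, clarify)
      fix j e j' e' assume *: "e dvd m" "e' dvd m" "q ^ j * e = q ^ j' * e'"
      then have "j = j'" using mult by metis
      then show "j = j' \<and> e = e'" using * q by (auto simp: prime_gt_0_nat)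
    qed
    show "{d. d dvd q ^ k * m} = (\<lambda>(j,e). q ^ j * e) ` ({..k} \<times> {e. e dvd m})"
    proof (intro equalityI subsetI)
      fix d assume "d \<in> {d. d dvd q ^ k * m}"
      then obtain a e where ae: "d = a * e" "a dvd q ^ k" "e dvd m"
        using division_decomp by blast
      then obtain j where "j \<le> k" "a = q ^ j"
        using divides_primepow_nat[OF q] by blast
      then show "d \<in> (\<lambda>(j,e). q ^ j * e) ` ({..k} \<times> {e. e dvd m})"
        using ae by (intro image_eqI[of _ _ "(j,e)"]) auto
    qed (auto intro!: mult_dvd_mono le_imp_power_dvd)
  qed auto
  also have "\<dots> = (\<Sum>j\<le>k. \<Sum>e | e dvd m. F (q ^ j * e))"
    using m by (subst sum.cartesian_product) auto
  finally show ?thesis .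
qed

text \<open>Strips the full power of one prime; \<open>m < n\<close> lets strong induction prove
  facts about multiplicative functions one prime at a time.\<close>

lemma prime_power_mult_decompose:
  fixes n :: nat
  assumes "n > 1"
  obtains q k m where "prime q" "k > 0" "m > 0" "\<not> q dvd m" "n = q ^ k * m" "m < n"
proof -
  obtain q where q: "prime q" "q dvd n"
    using assms prime_factor_nat[of n] by auto
  obtain m where m: "n = q ^ multiplicity q n * m" "\<not> q dvd m"
    using assms q by (auto intro: multiplicity_decompose'[of n q])
  have k: "multiplicity q n > 0"
    using q assms by (simp add: prime_multiplicity_gt_zero_iff)
  have "m > 0" using m assms by (intro Nat.gr0I) auto
  moreover have "m < n"
  proof -
    have "1 < q ^ multiplicity q n"
      using k q prime_gt_1_nat[of q] by (intro one_less_power) auto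
    then have "1 * m < q ^ multiplicity q n * m"
      using \<open>m > 0\<close> by (intro mult_strict_right_mono) auto
    then show ?thesis by (simp flip: m(1))
  qed
  ultimately show ?thesis using that q m k by blast
qed

section \<open>The Moebius function and inversion of the logarithm\<close>

definition moebius :: "nat \<Rightarrow> real" where
  "moebius n = (if squarefree n then (-1) ^ card (prime_factors n) else 0)"

lemma moebius_1 [simp]: "moebius 1 = 1" "moebius (Suc 0) = 1"
  by (simp_all add: moebius_def)

lemma abs_moebius_le: "\<bar>moebius n\<bar> \<le> 1"
  by (simp add: moebius_def power_abs)

lemma moebius_prime_mult:
  assumes "prime q" "\<not> q dvd m"
  shows "moebius (q * m) = - moebius m"
proof -
  have "m \<noteq> 0" using assms by (metis dvd_0_right)
  have "coprime q m" using assms by (simp add: prime_imp_coprime)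
  then have "squarefree (q * m) \<longleftrightarrow> squarefree m"
    using assms by (auto intro: squarefree_mult_coprime squarefree_prime dest: squarefree_multD)
  moreover have "prime_factors (q * m) = insert q (prime_factors m)" "q \<notin> prime_factors m"
    using assms \<open>m \<noteq> 0\<close> by (auto simp: prime_factors_dvd prime_dvd_mult_iff dest: primes_dvd_imp_eq)
  ultimately show ?thesis by (simp add: moebius_def)
qed

lemma moebius_prime_power_mult:
  assumes "prime q" "j \<ge> 2"
  shows "moebius (q ^ j * m) = 0"
proof -
  have "q\<^sup>2 dvd q ^ j * m" using assms by (intro dvd_mult2 le_imp_power_dvd)
  moreover have "\<not> is_unit q" using assms by auto
  ultimately show ?thesis by (auto simp: moebius_def squarefree_def)
qed

text \<open>Split off one prime power \<open>q ^ k\<close>: exponents \<open>j \<ge> 2\<close>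
  contribute 0, and the terms for \<open>j = 0\<close> and \<open>j = 1\<close> cancel.\<close>

lemma sum_moebius_divisors:
  assumes "n > 0"
  shows "(\<Sum>d | d dvd n. moebius d) = (if n = 1 then 1 else 0)"
proof (cases "n = 1")
  case False
  then obtain q k m where qkm: "prime q" "k > 0" "m > 0" "\<not> q dvd m" "n = q ^ k * m"
    using prime_power_mult_decompose[of n] assms by (metis Suc_lessI One_nat_def)
  have nd: "\<not> q dvd e" if "e dvd m" for e using that qkm dvd_trans by blast
  have "(\<Sum>d | d dvd n. moebius d) = (\<Sum>j\<le>k. \<Sum>e | e dvd m. moebius (q ^ j * e))"
    using qkm by (simp add: sum_divisors_prime_power_mult)
  also have "\<dots> = (\<Sum>j\<in>{0,1}. \<Sum>e | e dvd m. moebius (q ^ j * e))"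
    using qkm by (intro sum.mono_neutral_right) (auto simp: moebius_prime_power_mult intro!: sum.neutral)
  also have "\<dots> = (\<Sum>e | e dvd m. moebius e + moebius (q * e))"
    by (simp add: sum.distrib)
  also have "\<dots> = 0"
    using qkm nd by (intro sum.neutral) (auto simp: moebius_prime_mult)
  finally show ?thesis using False by simp
qed simp

text \<open>Moebius inversion of \<open>ln = 1 * mangoldt\<close>: expand the logarithm, swap the
  two divisor sums, and the inner sum over \<open>d\<close> is nonzero only for
  \<open>e = n\<close>.\<close>

lemma sum_moebius_ln_divisors:
  assumes "n > 0"
  shows "(\<Sum>d | d dvd n. moebius d * ln (real (n div d))) = mangoldt n"
proof -
  have "(\<Sum>d | d dvd n. moebius d * ln (real (n div d)))
      = (\<Sum>d | d dvd n. \<Sum>e | e \<in> {e. e dvd n} \<and> d * e dvd n. moebius d * mangoldt e)"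
  proof (intro sum.cong refl)
    fix d assume "d \<in> {d. d dvd n}"
    then have d: "d dvd n" "n div d > 0" "d > 0"
      using assms by (auto simp: div_greater_zero_iff dvd_imp_le intro: dvd_pos_nat)
    have "ln (real (n div d)) = (\<Sum>e | e dvd n div d. mangoldt e)"
      using d by (subst mangoldt_sum) auto
    also have "{e. e dvd n div d} = {e. e \<in> {e. e dvd n} \<and> d * e dvd n}"
      using d by (auto simp: dvd_div_iff_mult mult.commute[of d] dest: dvd_mult_left)
    finally show "moebius d * ln (real (n div d))
        = (\<Sum>e | e \<in> {e. e dvd n} \<and> d * e dvd n. moebius d * mangoldt e)"
      by (simp add: sum_distrib_left)
  qed
  also have "\<dots> = (\<Sum>e | e dvd n. \<Sum>d | d \<in> {d. d dvd n} \<and> d * e dvd n. moebius d * mangoldt e)"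
    using assms by (intro sum.swap_restrict) auto
  also have "\<dots> = (\<Sum>e | e dvd n. if e = n then mangoldt e else 0)"
  proof (intro sum.cong refl)
    fix e assume "e \<in> {e. e dvd n}"
    then have e: "e dvd n" "n div e > 0" "e > 0"
      using assms by (auto simp: div_greater_zero_iff dvd_imp_le intro: dvd_pos_nat)
    have "{d. d \<in> {d. d dvd n} \<and> d * e dvd n} = {d. d dvd n div e}"
      using e by (auto simp: dvd_div_iff_mult dest: dvd_mult_left)
    then have "(\<Sum>d | d \<in> {d. d dvd n} \<and> d * e dvd n. moebius d * mangoldt e)
        = (\<Sum>d | d dvd n div e. moebius d) * mangoldt e"
      by (simp add: sum_distrib_right)
    then show "(\<Sum>d | d \<in> {d. d dvd n} \<and> d * e dvd n. moebius d * mangoldt e)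
        = (if e = n then mangoldt e else 0)"
      using e assms by (auto simp: sum_moebius_divisors elim!: dvdE)
  qed
  also have "\<dots> = mangoldt n"
    using assms by simp
  finally show ?thesis .
qed

section \<open>Divisor sums of real characters\<close>

lemma sum_power_signs:
  assumes "x \<in> {-1, 0, 1::real}"
  shows "(\<Sum>j\<le>k. x ^ j) \<ge> 0" "even k \<Longrightarrow> (\<Sum>j\<le>k. x ^ j) \<ge> 1"
proof -
  have alt: "(\<Sum>j\<le>k. (-1::real) ^ j) = (if even k then 1 else 0)"
    by (induction k) auto
  have zero: "(\<Sum>j\<le>k. (0::real) ^ j) = 1"
    by (induction k) auto
  from assms show "(\<Sum>j\<le>k. x ^ j) \<ge> 0" "even k \<Longrightarrow> (\<Sum>j\<le>k. x ^ j) \<ge> 1"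
    using alt zero by auto
qed

locale sign_character =
  fixes f :: "nat \<Rightarrow> real"
  assumes mult: "f (a * b) = f a * f b" and one: "f 1 = 1" and signs: "f n \<in> {-1, 0, 1}"
begin

lemma power: "f (a ^ j) = f a ^ j"
  using one by (induction j) (auto simp: mult)

text \<open>The divisor sum \<open>1 * f\<close> is multiplicative, and its factor at
  \<open>q ^ k\<close> is a geometric sum in \<open>f q\<close>.\<close>

lemma sum_divisors_decompose:
  assumes "prime q" "m > 0" "\<not> q dvd m"
  shows "(\<Sum>d | d dvd q ^ k * m. f d) = (\<Sum>j\<le>k. f q ^ j) * (\<Sum>d | d dvd m. f d)"
  using assms by (simp add: sum_divisors_prime_power_mult mult power sum_product)

lemma sum_divisors_nonneg: "n > 0 \<Longrightarrow> (\<Sum>d | d dvd n. f d) \<ge> 0"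
proof (induction n rule: less_induct)
  case (less n)
  show ?case
  proof (cases "n = 1")
    case False
    then obtain q k m where qkm: "prime q" "k > 0" "m > 0" "\<not> q dvd m" "n = q ^ k * m" "m < n"
      using prime_power_mult_decompose[of n] less.prems by (metis Suc_lessI One_nat_def)
    then show ?thesis
      using less.IH[of m] sum_power_signs(1)[OF signs[of q], of k] by (simp add: sum_divisors_decompose)
  qed (use one in simp)
qed

text \<open>In a square all prime exponents are even, so even for \<open>f q = -1\<close> each
  alternating local sum equals 1 rather than 0.\<close>

lemma sum_divisors_square_ge_1: "n > 0 \<Longrightarrow> (\<Sum>d | d dvd n\<^sup>2. f d) \<ge> 1"
proof (induction n rule: less_induct)
  case (less n)
  show ?case
  proof (cases "n = 1")
    case False
    then obtain q k m where qkm: "prime q" "k > 0" "m > 0" "\<not> q dvd m" "n = q ^ k * m" "m < n"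
      using prime_power_mult_decompose[of n] less.prems by (metis Suc_lessI One_nat_def)
    have n2: "n\<^sup>2 = q ^ (2 * k) * m\<^sup>2"
      using qkm by (simp add: power_mult_distrib power_mult [symmetric] mult.commute)
    have "\<not> q dvd m\<^sup>2" using qkm prime_dvd_power by blast
    then have "(\<Sum>d | d dvd n\<^sup>2. f d) = (\<Sum>j\<le>2*k. f q ^ j) * (\<Sum>d | d dvd m\<^sup>2. f d)"
      unfolding n2 using qkm by (intro sum_divisors_decompose) auto
    moreover have "1 * 1 \<le> (\<Sum>j\<le>2*k. f q ^ j) * (\<Sum>d | d dvd m\<^sup>2. f d)"
      using less.IH[of m] sum_power_signs(2)[OF signs[of q], of "2*k"] qkm by (intro mult_mono) auto
    ultimately show ?thesis by simp
  qed (use one in simp)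
qed

end

section \<open>Bounded completely multiplicative functions\<close>

lemma sum_split_at:
  fixes f :: "nat \<Rightarrow> 'a::comm_monoid_add"
  shows "M \<le> N \<Longrightarrow> sum f {1..N} = sum f {1..M} + sum f {Suc M..N}"
  using sum.ub_add_nat[of 1 M f "N - M"] by simp

definition harmonic_partial_sum :: "(nat \<Rightarrow> complex) \<Rightarrow> nat \<Rightarrow> complex" where
  "harmonic_partial_sum \<psi> N = (\<Sum>n=1..N. \<psi> n / of_nat n)"

definition mangoldt_partial_sum :: "(nat \<Rightarrow> complex) \<Rightarrow> nat \<Rightarrow> complex" where
  "mangoldt_partial_sum \<psi> N = (\<Sum>n=1..N. \<psi> n * mangoldt n / of_nat n)"

text \<open>The value at 1 of the Dirichlet L-series. The limit is meaningful only where the series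
  converges, which \<open>A_tendsto\<close> shows for bounded characters.\<close>

definition L_at_1 :: "(nat \<Rightarrow> complex) \<Rightarrow> complex" where
  "L_at_1 \<psi> = lim (harmonic_partial_sum \<psi>)"

text \<open>The bound \<open>B\<close> on the partial sums stands for both periodicity and
  nontriviality: for a nonprincipal character a whole period sums to 0.\<close>

locale bounded_character =
  fixes \<psi> :: "nat \<Rightarrow> complex" and B :: real
  assumes mult: "\<psi> (a * b) = \<psi> a * \<psi> b" and one: "\<psi> 1 = 1"
    and norm_le: "norm (\<psi> n) \<le> 1" and partial_sums: "norm (\<Sum>i=1..n. \<psi> i) \<le> B"
begin

abbreviation A where "A \<equiv> harmonic_partial_sum \<psi>"
abbreviation S where "S \<equiv> mangoldt_partial_sum \<psi>"
abbreviation L where "L \<equiv> L_at_1 \<psi>"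

lemma B_nonneg: "B \<ge> 0"
  using norm_ge_zero partial_sums[of 0] by (rule order_trans)

section \<open>Convergence of the L-series at 1, with a rate\<close>

lemma norm_A_diff_le:
  assumes "M \<le> N"
  shows "norm (A N - A M) \<le> 2 * B / real (Suc M)"
proof -
  have "A N - A M = (\<Sum>n=Suc M..N. \<psi> n * of_real (1 / real n))"
    using sum_split_at[OF assms, of "\<lambda>n. \<psi> n / of_nat n"] by (simp add: harmonic_partial_sum_def)
  also have "norm \<dots> \<le> 2 * B * (1 / real (Suc M))"
    by (rule norm_sum_mult_antimono_le[OF partial_sums]) (auto simp: field_simps)
  finally show ?thesis by simp
qed

lemma A_tendsto: "A \<longlonglongrightarrow> L"
proof -
  have "(\<lambda>M. 2 * B / real (Suc M)) \<longlonglongrightarrow> 0"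
    by (rule LIMSEQ_Suc) (rule lim_const_over_n)
  have "Cauchy A"
  proof (rule CauchyI')
    fix e :: real assume "e > 0"
    with \<open>_ \<longlonglongrightarrow> 0\<close> obtain M where M: "2 * B / real (Suc M) < e"
      by (metis (no_types, lifting) eventually_sequentially order_refl order_tendstoD(2))
    have "norm (A m - A n) < e" if "m \<ge> M" "n > m" for m n
    proof -
      have "norm (A m - A n) \<le> 2 * B / real (Suc m)"
        using norm_A_diff_le[of m n] that by (simp add: norm_minus_commute)
      also have "\<dots> \<le> 2 * B / real (Suc M)"
        using that B_nonneg by (intro divide_left_mono) auto
      finally show ?thesis using M by simp
    qed
    then show "\<exists>M. \<forall>m\<ge>M. \<forall>n>m. dist (A m) (A n) < e"
      unfolding dist_norm by blast
  qed
  then show ?thesis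
    unfolding L_at_1_def by (simp add: Cauchy_convergent convergent_LIMSEQ_iff [symmetric])
qed

lemma norm_A_minus_L_le: "norm (A M - L) \<le> 2 * B / real (Suc M)"
proof (rule tendsto_upperbound)
  show "(\<lambda>N. norm (A M - A N)) \<longlonglongrightarrow> norm (A M - L)"
    by (intro tendsto_intros A_tendsto)
  show "\<forall>\<^sub>F N in sequentially. norm (A M - A N) \<le> 2 * B / real (Suc M)"
    using norm_A_diff_le by (intro eventually_sequentiallyI[of M]) (subst norm_minus_commute)
qed auto

text \<open>The error grows linearly in \<open>d\<close>, so it cancels the denominator of weights
  such as \<open>\<psi> d * mangoldt d / d\<close>.\<close>

lemma norm_A_div_minus_L_le:
  assumes "d \<in> {1..N}"
  shows "norm (A (N div d) - L) \<le> 2 * B * real d / real N"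
proof -
  have "norm (A (N div d) - L) \<le> 2 * B / real (N div d + 1)"
    using norm_A_minus_L_le[of "N div d"] by simp
  also have "\<dots> \<le> 2 * B / (real N / real d)"
    using assms B_nonneg real_div_nat_gt[of d N] by (intro divide_left_mono) auto
  finally show ?thesis by simp
qed

section \<open>Mertens sums twisted by a character\<close>

lemma sum_ln_bounded: "\<exists>C. \<forall>N. norm (\<Sum>n=1..N. \<psi> n * of_real (ln (real n) / real n)) \<le> C"
proof -
  let ?f = "\<lambda>n. \<psi> n * of_real (ln (real n) / real n)"
  \<comment> \<open>The weight \<open>ln n / n\<close> decreases only beyond \<open>exp 1\<close>,
    so partial summation starts at 3.\<close>
  have tail: "norm (\<Sum>n=Suc 2..N. ?f n) \<le> 2 * B * (ln (real (Suc 2)) / real (Suc 2))" for N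
  proof (rule norm_sum_mult_antimono_le[OF partial_sums])
    fix n :: nat assume n: "2 < n"
    have "ln (real (Suc n) / real n) = ln (1 + 1 / real n)"
      using n by (simp add: field_simps)
    also have "\<dots> \<le> 1 / real n"
      by (rule ln_add_one_self_le_self) simp
    finally have "real n * (ln (real (Suc n)) - ln (real n)) \<le> 1"
      using n by (simp add: ln_div field_simps)
    moreover have "exp 1 \<le> real n" using exp_le n by linarith
    then have "1 \<le> ln (real n)" using n by (subst ln_ge_iff) auto
    ultimately show "ln (real (Suc n)) / real (Suc n) \<le> ln (real n) / real n"
      using n by (simp add: divide_simps algebra_simps)
  qed auto
  \<comment> \<open>The summand \<open>norm (?f 1)\<close> covers the case \<open>N = 1\<close>,
    where the first block is incomplete.\<close>
  have "norm (\<Sum>n=1..N. ?f n)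
      \<le> norm (\<Sum>n=1..2. ?f n) + 2 * B * (ln (real (Suc 2)) / real (Suc 2)) + norm (?f 1)" for N
  proof (cases "N \<ge> 2")
    case True
    then have split: "(\<Sum>n=1..N. ?f n) = (\<Sum>n=1..2. ?f n) + (\<Sum>n=Suc 2..N. ?f n)"
      by (rule sum_split_at)
    show ?thesis
      unfolding split using norm_triangle_ineq[of "\<Sum>n=1..2. ?f n" "\<Sum>n=Suc 2..N. ?f n"] tail[of N] norm_ge_zero[of "?f 1"]
      by linarith
  next
    case False
    then consider "N = 0" | "N = 1" by linarith
    then show ?thesis using B_nonneg by cases auto
  qed
  then show ?thesis by blast
qed

text \<open>Inserting \<open>ln = 1 * mangoldt\<close> into the bounded sum of
  \<open>sum_ln_bounded\<close> gives a sum of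
  \<open>\<psi> d * mangoldt d / d * A (N div d)\<close>. Replacing each \<open>A (N div d)\<close>
  by \<open>L\<close> costs \<open>mangoldt d * 2 * B / N\<close>, in total at most
  \<open>8 * B\<close> by Chebyshev.\<close>

lemma L_times_S_bounded: "\<exists>C. \<forall>N. norm (L * S N) \<le> C"
proof -
  obtain C where C: "\<And>N. norm (\<Sum>n=1..N. \<psi> n * of_real (ln (real n) / real n)) \<le> C"
    using sum_ln_bounded by blast
  have "norm (L * S N) \<le> C + 8 * B" for N
  proof (cases "N = 0")
    case False
    let ?T = "\<Sum>n=1..N. \<psi> n * of_real (ln (real n) / real n)"
    let ?w = "\<lambda>d. \<psi> d * mangoldt d / of_nat d"
    have "?T = (\<Sum>n=1..N. \<Sum>d | d dvd n. ?w d * (\<psi> (n div d) / of_nat (n div d)))"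
    proof (intro sum.cong refl)
      fix n assume n: "n \<in> {1..N}"
      have "(\<Sum>d | d dvd n. ?w d * (\<psi> (n div d) / of_nat (n div d)))
          = (\<Sum>d | d dvd n. \<psi> n / of_nat n * mangoldt d)"
        using n by (intro sum.cong refl) (auto elim!: dvdE simp: mult)
      also have "\<dots> = \<psi> n / of_nat n * of_real (ln (real n))"
        using n by (subst sum_distrib_left [symmetric], subst mangoldt_sum) auto
      finally show "\<psi> n * of_real (ln (real n) / real n)
          = (\<Sum>d | d dvd n. ?w d * (\<psi> (n div d) / of_nat (n div d)))"
        by simp
    qed
    also have "\<dots> = (\<Sum>d=1..N. ?w d * A (N div d))"
      by (subst sum_divisors_swap) (simp add: harmonic_partial_sum_def sum_distrib_left)
    finally have "?T = (\<Sum>d=1..N. ?w d * A (N div d))" .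
    moreover have "L * S N = (\<Sum>d=1..N. ?w d * L)"
      by (simp add: mangoldt_partial_sum_def sum_distrib_left mult_ac)
    ultimately have "?T - L * S N = (\<Sum>d=1..N. ?w d * (A (N div d) - L))"
      by (simp only: right_diff_distrib sum_subtractf)
    also have "norm \<dots> \<le> (\<Sum>d=1..N. mangoldt d * (2 * B / real N))"
    proof (rule sum_norm_le)
      fix d assume d: "d \<in> {1..N}"
      have "norm (?w d * (A (N div d) - L)) \<le> (1 * mangoldt d / real d) * (2 * B * real d / real N)"
        unfolding norm_mult norm_divide norm_of_nat norm_mangoldt
        using norm_A_div_minus_L_le[OF d] B_nonneg norm_le mangoldt_nonneg
        by (intro mult_mono divide_right_mono) auto
      then show "norm (?w d * (A (N div d) - L)) \<le> mangoldt d * (2 * B / real N)"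
        using d by simp
    qed
    also have "\<dots> = (\<Sum>d=1..N. mangoldt d) * (2 * B / real N)"
      by (rule sum_distrib_right [symmetric])
    also have "\<dots> \<le> 4 * real N * (2 * B / real N)"
      using B_nonneg by (intro mult_right_mono sum_mangoldt_le) auto
    also have "\<dots> = 8 * B" using False by simp
    finally show ?thesis
      using C[of N] norm_triangle_ineq2[of "L * S N" ?T] by (simp add: norm_minus_commute)
  qed (use C[of 0] B_nonneg in \<open>auto simp: mangoldt_partial_sum_def\<close>)
  then show ?thesis by blast
qed

lemma S_bounded_if_L_nonzero:
  assumes "L \<noteq> 0"
  shows "\<exists>C. \<forall>N. norm (S N) \<le> C"
proof -
  obtain C where "\<And>N. norm (L * S N) \<le> C" using L_times_S_bounded by blast
  then have "norm (S N) \<le> C / norm L" for N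
    using assms by (simp add: norm_mult field_simps)
  then show ?thesis by blast
qed

text \<open>Convolving \<open>\<psi> d * moebius d * (ln N - ln d)\<close> with
  \<open>\<psi>\<close> produces \<open>ln N\<close> at \<open>n = 1\<close> plus the von Mangoldt
  terms. As \<open>L = 0\<close>, each \<open>A (N div d)\<close> is itself at most
  \<open>2 * B * d / N\<close>, and the nonnegative weights \<open>ln N - ln d\<close> add up to at
  most \<open>N\<close> by \<open>ln_fact_ge\<close>.\<close>

lemma S_asymptotics_if_L_zero:
  assumes "L = 0" "N > 0"
  shows "norm (of_real (ln (real N)) + S N) \<le> 2 * B"
proof -
  let ?w = "\<lambda>d. of_real (moebius d * (ln (real N) - ln (real d))) * \<psi> d / of_nat d"
  have "of_real (ln (real N)) + S N
      = (\<Sum>n=1..N. (if n = 1 then of_real (ln (real N)) else 0) + \<psi> n * mangoldt n / of_nat n)"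
    using assms by (simp add: mangoldt_partial_sum_def sum.distrib)
  also have "\<dots> = (\<Sum>n=1..N. \<Sum>d | d dvd n. ?w d * (\<psi> (n div d) / of_nat (n div d)))"
  proof (intro sum.cong refl)
    fix n assume n: "n \<in> {1..N}"
    have "(\<Sum>d | d dvd n. ?w d * (\<psi> (n div d) / of_nat (n div d)))
        = (\<Sum>d | d dvd n. \<psi> n / of_nat n * of_real (moebius d * (ln (real N) - ln (real d))))"
      using n by (intro sum.cong refl) (auto elim!: dvdE simp: mult)
    also have "\<dots> = \<psi> n / of_nat n * of_real (\<Sum>d | d dvd n. moebius d * (ln (real N) - ln (real d)))"
      by (simp add: sum_distrib_left)
    \<comment> \<open>Writing \<open>ln N - ln d\<close> as
      \<open>(ln N - ln n) + ln (n div d)\<close> separates the two Moebius identities.\<close>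
    also have "(\<Sum>d | d dvd n. moebius d * (ln (real N) - ln (real d)))
        = (\<Sum>d | d dvd n. moebius d * (ln (real N) - ln (real n)) + moebius d * ln (real (n div d)))"
      using n by (intro sum.cong refl) (auto elim!: dvdE simp: ln_mult algebra_simps)
    also have "\<dots> = (\<Sum>d | d dvd n. moebius d) * (ln (real N) - ln (real n)) + mangoldt n"
      using n by (simp add: sum.distrib sum_distrib_right sum_moebius_ln_divisors)
    also have "\<dots> = (if n = 1 then ln (real N) else 0) + mangoldt n"
      using n by (simp add: sum_moebius_divisors)
    finally show "(if n = 1 then of_real (ln (real N)) else 0) + \<psi> n * mangoldt n / of_nat n
        = (\<Sum>d | d dvd n. ?w d * (\<psi> (n div d) / of_nat (n div d)))"
      using one by auto
  qed
  also have "\<dots> = (\<Sum>d=1..N. ?w d * A (N div d))"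
    by (subst sum_divisors_swap) (simp add: harmonic_partial_sum_def sum_distrib_left)
  also have "norm \<dots> \<le> (\<Sum>d=1..N. (ln (real N) - ln (real d)) * (2 * B / real N))"
  proof (rule sum_norm_le)
    fix d assume d: "d \<in> {1..N}"
    have ln_le: "ln (real d) \<le> ln (real N)" using d by simp
    have "norm (?w d * A (N div d))
        \<le> ((1 * (ln (real N) - ln (real d))) * 1 / real d) * (2 * B * real d / real N)"
      unfolding norm_mult norm_divide norm_of_nat norm_of_real abs_mult
      using norm_A_div_minus_L_le[OF d] B_nonneg norm_le abs_moebius_le ln_le assms
      by (intro mult_mono divide_right_mono) auto
    then show "norm (?w d * A (N div d)) \<le> (ln (real N) - ln (real d)) * (2 * B / real N)"
      using d by simp
  qed
  also have "\<dots> = (real N * ln (real N) - ln (fact N)) * (2 * B / real N)"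
    by (simp only: sum_distrib_right [symmetric] sum_subtractf sum_ln_eq_ln_fact) simp
  also have "\<dots> \<le> real N * (2 * B / real N)"
    using ln_fact_ge[of N] assms B_nonneg by (intro mult_right_mono) auto
  also have "\<dots> = 2 * B" using assms by simp
  finally show ?thesis .
qed

text \<open>A one-sided bound available before it is known whether \<open>L\<close> vanishes; it
  controls the remaining characters when two are assumed to have \<open>L = 0\<close>.\<close>

lemma Re_S_bounded_above: "\<exists>C. \<forall>N>0. Re (S N) \<le> C"
proof (cases "L = 0")
  case True
  have "Re (S N) \<le> 2 * B" if "N > 0" for N
  proof -
    have "Re (of_real (ln (real N)) + S N) \<le> 2 * B"
      using S_asymptotics_if_L_zero[OF True that] complex_Re_le_cmod order_trans by blast
    moreover have "ln (real N) \<ge> 0" using that by simp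
    ultimately show ?thesis by simp
  qed
  then show ?thesis by blast
next
  case False
  then show ?thesis
    using S_bounded_if_L_nonzero complex_Re_le_cmod order_trans by blast
qed

end

section \<open>Nonvanishing for real characters\<close>

text \<open>Pair the exponents \<open>i\<close> and \<open>m - i\<close> and use
  \<open>2 * a * b \<le> a ^ 2 + b ^ 2\<close>; the product of \<open>u ^ i\<close> and
  \<open>u ^ (m - i)\<close> is always \<open>u ^ m\<close>.\<close>

lemma sum_powers_ge:
  fixes u :: real
  shows "(\<Sum>i<Suc m. (u\<^sup>2) ^ i) \<ge> real (Suc m) * u ^ m"
proof -
  have "2 * (real (Suc m) * u ^ m) = (\<Sum>i<Suc m. 2 * u ^ m)" by simp
  also have "\<dots> \<le> (\<Sum>i<Suc m. (u\<^sup>2) ^ i + (u\<^sup>2) ^ (Suc m - Suc i))"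
  proof (rule sum_mono)
    fix i assume "i \<in> {..<Suc m}"
    then have "u ^ m = u ^ i * u ^ (Suc m - Suc i)"
      by (simp flip: power_add)
    then show "2 * u ^ m \<le> (u\<^sup>2) ^ i + (u\<^sup>2) ^ (Suc m - Suc i)"
      using sum_squares_bound[of "u ^ i" "u ^ (Suc m - Suc i)"]
      by (simp flip: power_mult add: mult_ac)
  qed
  also have "\<dots> = 2 * (\<Sum>i<Suc m. (u\<^sup>2) ^ i)"
    by (simp only: sum.distrib sum.nat_diff_reindex mult_2)
  finally show ?thesis by simp
qed

text \<open>
  If \<open>L = 0\<close>, the sum of \<open>\<psi> n * (t ^ n / (1 - t ^ n))\<close> equals minus that of \<open>\<psi> n * lambert_gap t n\<close>.
  The latter is bounded uniformly in \<open>t\<close> by partial summation, because the gap decreases in \<open>n\<close>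
  from the value 1.
\<close>
definition lambert_gap :: "real \<Rightarrow> nat \<Rightarrow> real" where
  "lambert_gap t n = 1 / (real n * (1 - t)) - t ^ n / (1 - t ^ n)"

lemma lambert_gap_1: "0 < t \<Longrightarrow> t < 1 \<Longrightarrow> lambert_gap t (Suc 0) = 1"
  by (simp add: lambert_gap_def diff_divide_distrib [symmetric])

lemma one_minus_power_eq: "1 - t ^ n = (1 - t) * (\<Sum>i<n. t ^ i)" for t :: real
  using one_diff_power_eq[of t n] by simp

lemma sum_powers_pos: "0 < t \<Longrightarrow> n > 0 \<Longrightarrow> (\<Sum>i<n. t ^ i) > 0" for t :: real
  by (intro sum_pos) auto

lemma lambert_gap_nonneg:
  assumes t: "0 < t" "t < 1" and n: "n > 0"
  shows "lambert_gap t n \<ge> 0"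
proof -
  have "(\<Sum>i<n. t ^ n) \<le> (\<Sum>i<n. t ^ i)"
    using t by (intro sum_mono power_decreasing) auto
  then have "real n * t ^ n \<le> (\<Sum>i<n. t ^ i)" by simp
  then show ?thesis
    unfolding lambert_gap_def one_minus_power_eq using sum_powers_pos[of t n] t n
    by (simp add: divide_simps mult.commute)
qed

text \<open>With \<open>s n = (1 - t ^ n) / (1 - t)\<close>, the recursion
  \<open>s (Suc n) = 1 + t * s n\<close> reduces the claim to
  \<open>n * (n + 1) * t ^ n \<le> s n * s (Suc n)\<close>, which follows from
  \<open>sum_powers_ge\<close> for both factors.\<close>

lemma lambert_gap_antimono:
  assumes t: "0 < t" "t < 1" and n: "n > 0"
  shows "lambert_gap t (Suc n) \<le> lambert_gap t n"
proof -
  \<comment> \<open>The square root expresses the half-integral powers of \<open>t\<close> that the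
    pairing of exponents produces.\<close>
  define u where "u = sqrt t"
  have u: "0 < u" "u < 1" "u\<^sup>2 = t"
    using t by (auto simp: u_def)
  define s where "s n = (\<Sum>i<n. t ^ i)" for n
  have s_pos: "s n > 0" "s (Suc n) > 0"
    using sum_powers_pos[of t] t n by (simp_all add: s_def del: sum.lessThan_Suc)
  have "real n * u ^ n * (real (Suc n) * u ^ n) \<le> s n * s (Suc n)"
  proof (rule mult_mono)
    obtain m where m: "n = Suc m" using n gr0_implies_Suc by blast
    have "real n * u ^ n \<le> real n * u ^ m"
      using u m by (intro mult_left_mono power_decreasing) auto
    also have "\<dots> \<le> s n"
      using sum_powers_ge[of m u] u m by (simp add: s_def)
    finally show "real n * u ^ n \<le> s n" .
    show "real (Suc n) * u ^ n \<le> s (Suc n)"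
      using sum_powers_ge[of n u] u by (simp add: s_def)
  qed (use s_pos u in auto)
  also have "real n * u ^ n * (real (Suc n) * u ^ n) = real n * real (Suc n) * t ^ n"
    by (simp add: u(3) [symmetric] power_mult [symmetric] power2_eq_square power_mult_distrib)
  finally have key: "t ^ n / (s n * s (Suc n)) \<le> 1 / (real n * real (Suc n))"
    using s_pos n by (simp add: divide_simps mult_ac)
  have "s (Suc n) = 1 + t * s n"
    unfolding s_def by (subst sum.lessThan_Suc_shift) (simp add: sum_distrib_left)
  then have "t ^ n / s n - t ^ Suc n / s (Suc n) = t ^ n / (s n * s (Suc n))"
    using s_pos by (simp add: field_simps)
  moreover have "1 / real n - 1 / real (Suc n) = 1 / (real n * real (Suc n))"
    using n by (simp add: field_simps)
  ultimately have "1 / real (Suc n) - t ^ Suc n / s (Suc n) \<le> 1 / real n - t ^ n / s n"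
    using key by linarith
  then have "(1 / real (Suc n) - t ^ Suc n / s (Suc n)) / (1 - t) \<le> (1 / real n - t ^ n / s n) / (1 - t)"
    using t by (intro divide_right_mono) auto
  then show ?thesis
    unfolding lambert_gap_def one_minus_power_eq s_def by (simp add: diff_divide_distrib mult.commute)
qed

section \<open>The Lambert series of a real character\<close>

locale real_character = bounded_character +
  assumes signs: "\<psi> n \<in> {-1, 0, 1}"
begin

lemma sign_character_Re: "sign_character (\<lambda>n. Re (\<psi> n))"
proof
  show "Re (\<psi> n) \<in> {-1, 0, 1}" for n using signs[of n] by auto
  then show "Re (\<psi> (a * b)) = Re (\<psi> a) * Re (\<psi> b)" for a b
    using signs[of a] signs[of b] by (auto simp: mult)
qed (simp add: one[simplified])

text \<open>At a finite \<open>N\<close> the harmonic part leaves \<open>Re (A N) / (1 - t)\<close>,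
  which \<open>L = 0\<close> makes small as \<open>N\<close> grows; the gap part costs
  \<open>2 * B\<close>.\<close>

lemma sum_lambert_le:
  assumes t: "0 < t" "t < 1" and L: "L = 0"
  shows "(\<Sum>n=1..N. Re (\<psi> n) * (t ^ n / (1 - t ^ n))) \<le> 2 * B / (real (Suc N) * (1 - t)) + 2 * B"
proof -
  have "(\<Sum>n=1..N. Re (\<psi> n) * (t ^ n / (1 - t ^ n)))
      = Re (A N) / (1 - t) - (\<Sum>n=1..N. Re (\<psi> n) * lambert_gap t n)"
    by (simp add: harmonic_partial_sum_def lambert_gap_def algebra_simps sum_subtractf sum_divide_distrib)
  moreover have "Re (A N) / (1 - t) \<le> 2 * B / real (Suc N) / (1 - t)"
    using t norm_A_minus_L_le[of N] L complex_Re_le_cmod[of "A N"] by (intro divide_right_mono) auto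
  moreover have "norm (\<Sum>n=Suc 0..N. \<psi> n * of_real (lambert_gap t n)) \<le> 2 * B * lambert_gap t (Suc 0)"
    using t lambert_gap_antimono lambert_gap_nonneg
    by (intro norm_sum_mult_antimono_le[OF partial_sums]) auto
  then have "- (\<Sum>n=1..N. Re (\<psi> n) * lambert_gap t n) \<le> 2 * B"
    using abs_Re_le_cmod[of "\<Sum>n=1..N. \<psi> n * of_real (lambert_gap t n)"] t
    by (simp add: lambert_gap_1)
  ultimately show ?thesis by simp
qed

text \<open>The divisor swap gives geometric sums cut off at \<open>N div d\<close>. Each product
  with \<open>Re (\<psi> d)\<close> exceeds its untruncated value by at most
  \<open>t ^ N / (1 - t)\<close>, since the first omitted exponent \<open>d * (N div d + 1)\<close>
  is beyond \<open>N\<close>.\<close>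

lemma sum_divisor_sums_le:
  assumes t: "0 < t" "t < 1" and L: "L = 0"
  shows "(\<Sum>n=1..N. (\<Sum>d | d dvd n. Re (\<psi> d)) * t ^ n)
    \<le> 2 * B / (real (Suc N) * (1 - t)) + 2 * B + real N * t ^ N / (1 - t)"
proof -
  have geometric: "Re (\<psi> d) * (\<Sum>m=1..N div d. (t ^ d) ^ m)
      \<le> Re (\<psi> d) * (t ^ d / (1 - t ^ d)) + t ^ N / (1 - t)" if d: "d \<in> {1..N}" for d
  proof -
    have td: "t ^ d < 1" "t ^ d \<le> t"
      using t d power_decreasing[of 1 d t] by (auto simp: power_less_one_iff)
    have "(\<Sum>m=1..N div d. (t ^ d) ^ m) = t ^ d / (1 - t ^ d) - (t ^ d) ^ Suc (N div d) / (1 - t ^ d)"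
      using td d by (subst sum_gp) (auto simp: diff_divide_distrib div_greater_zero_iff)
    then have "Re (\<psi> d) * (\<Sum>m=1..N div d. (t ^ d) ^ m)
        = Re (\<psi> d) * (t ^ d / (1 - t ^ d)) - Re (\<psi> d) * ((t ^ d) ^ Suc (N div d) / (1 - t ^ d))"
      by (simp add: right_diff_distrib)
    moreover have "- Re (\<psi> d) * ((t ^ d) ^ Suc (N div d) / (1 - t ^ d)) \<le> 1 * (t ^ N / (1 - t))"
    proof (rule mult_mono)
      show "- Re (\<psi> d) \<le> 1" using signs[of d] by auto
      have "(t ^ d) ^ Suc (N div d) \<le> t ^ N"
        unfolding power_mult [symmetric] using t d
        by (intro power_decreasing) (auto simp: dividend_less_times_div less_imp_le)
      then show "(t ^ d) ^ Suc (N div d) / (1 - t ^ d) \<le> t ^ N / (1 - t)"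
        using t td by (intro frac_le) auto
    qed (use t td in auto)
    ultimately show ?thesis by simp
  qed
  have "(\<Sum>n=1..N. (\<Sum>d | d dvd n. Re (\<psi> d)) * t ^ n)
      = (\<Sum>n=1..N. \<Sum>d | d dvd n. Re (\<psi> d) * (t ^ d) ^ (n div d))"
    by (intro sum.cong refl) (auto simp: sum_distrib_right power_mult [symmetric])
  also have "\<dots> = (\<Sum>d=1..N. Re (\<psi> d) * (\<Sum>m=1..N div d. (t ^ d) ^ m))"
    by (subst sum_divisors_swap) (simp add: sum_distrib_left)
  also have "\<dots> \<le> (\<Sum>d=1..N. Re (\<psi> d) * (t ^ d / (1 - t ^ d)) + t ^ N / (1 - t))"
    by (intro sum_mono geometric)
  also have "\<dots> = (\<Sum>d=1..N. Re (\<psi> d) * (t ^ d / (1 - t ^ d))) + real N * t ^ N / (1 - t)"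
    by (simp add: sum.distrib)
  also have "\<dots> \<le> 2 * B / (real (Suc N) * (1 - t)) + 2 * B + real N * t ^ N / (1 - t)"
    using sum_lambert_le[OF assms] by simp
  finally show ?thesis .
qed

text \<open>Keep only the square indices, where the divisor sum is at least 1, and let
  \<open>N\<close> tend to infinity for fixed \<open>t\<close> and \<open>K\<close>: all error terms
  but \<open>2 * B\<close> vanish.\<close>

lemma sum_square_powers_le:
  assumes t: "0 < t" "t < 1" and L: "L = 0"
  shows "(\<Sum>k=1..K. t ^ k\<^sup>2) \<le> 2 * B"
proof (rule tendsto_lowerbound)
  interpret sign_character "\<lambda>n. Re (\<psi> n)" by (rule sign_character_Re)
  let ?b = "\<lambda>N. 2 * B / (1 - t) / real (Suc N) + 2 * B + real N * t ^ N / (1 - t)"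
  have "(\<lambda>N. real N * t ^ N) \<longlonglongrightarrow> 0"
    using t by (intro powser_times_n_limit_0) auto
  moreover have "(\<lambda>N. 2 * B / (1 - t) / real (Suc N)) \<longlonglongrightarrow> 0"
    by (rule LIMSEQ_Suc) (rule lim_const_over_n)
  ultimately have "?b \<longlonglongrightarrow> 0 + 2 * B + 0 / (1 - t)"
    using t by (intro tendsto_intros) auto
  then show "?b \<longlonglongrightarrow> 2 * B" by simp
  have "(\<Sum>k=1..K. t ^ k\<^sup>2) \<le> ?b N" if N: "N \<ge> K\<^sup>2" for N
  proof -
    have "(\<Sum>k=1..K. t ^ k\<^sup>2) \<le> (\<Sum>k=1..K. (\<Sum>d | d dvd k\<^sup>2. Re (\<psi> d)) * t ^ k\<^sup>2)"
    proof (rule sum_mono)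
      fix k assume "k \<in> {1..K}"
      then show "t ^ k\<^sup>2 \<le> (\<Sum>d | d dvd k\<^sup>2. Re (\<psi> d)) * t ^ k\<^sup>2"
        using sum_divisors_square_ge_1[of k] t mult_right_mono[of 1 _ "t ^ k\<^sup>2"] by simp
    qed
    also have "\<dots> = (\<Sum>n\<in>(\<lambda>k. k\<^sup>2) ` {1..K}. (\<Sum>d | d dvd n. Re (\<psi> d)) * t ^ n)"
      by (subst sum.reindex) (auto simp: inj_on_def power2_eq_iff_nonneg)
    also have "\<dots> \<le> (\<Sum>n=1..N. (\<Sum>d | d dvd n. Re (\<psi> d)) * t ^ n)"
    proof (rule sum_mono2)
      show "(\<lambda>k. k\<^sup>2) ` {1..K} \<subseteq> {1..N}"
        using N by (auto simp: Suc_le_eq intro: order_trans[OF power_mono])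
    qed (use t sum_divisors_nonneg in auto)
    also have "\<dots> \<le> ?b N"
      using sum_divisor_sums_le[OF assms, of N] by (simp add: mult.commute)
    finally show ?thesis .
  qed
  then show "\<forall>\<^sub>F N in sequentially. (\<Sum>k=1..K. t ^ k\<^sup>2) \<le> ?b N"
    by (intro eventually_sequentiallyI[of "K\<^sup>2"])
qed auto

lemma L_nonzero: "L \<noteq> 0"
proof
  assume L: "L = 0"
  obtain K :: nat where K: "real K > 4 * B + 1"
    using reals_Archimedean2 by blast
  then have "K > 0" using B_nonneg by (intro Nat.gr0I) auto
  \<comment> \<open>This \<open>t\<close> makes each of the first \<open>K\<close> square powers at
    least 1/2, so their sum is at least \<open>K / 2 > 2 * B\<close>.\<close>
  define t where "t = root (K\<^sup>2) (1 / 2)"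
  have t: "0 < t" "t < 1" "t ^ K\<^sup>2 = 1 / 2"
    using \<open>K > 0\<close> by (auto simp: t_def)
  have "real K * (1 / 2) = (\<Sum>k=1..K. t ^ K\<^sup>2)"
    using t by simp
  also have "\<dots> \<le> (\<Sum>k=1..K. t ^ k\<^sup>2)"
    using t by (intro sum_mono power_decreasing power_mono) auto
  also have "\<dots> \<le> 2 * B"
    by (rule sum_square_powers_le[OF t(1,2) L])
  finally show False using K by simp
qed

end

section \<open>Characters modulo a prime\<close>

lemma not_ln_bounded:
  assumes "\<And>N::nat. N > 0 \<Longrightarrow> ln (real N) \<le> C"
  shows False
proof -
  obtain N :: nat where N: "real N > exp (C + 1)"
    using reals_Archimedean2 by blast
  then have "real N > 0"
    using exp_gt_zero[of "C + 1"] by linarith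
  then have "C + 1 < ln (real N)"
    using N by (metis exp_less_cancel_iff exp_ln)
  then show False
    using assms[of N] \<open>real N > 0\<close> by simp
qed

lemma sum_powers_root_of_unity:
  fixes z :: complex
  assumes "z ^ n = 1"
  shows "(\<Sum>k<n. z ^ k) = (if z = 1 then of_nat n else 0)"
  using assms by (auto simp: geometric_sum)

locale prime_primroot =
  fixes p g :: nat
  assumes prime: "prime p" and primroot: "residue_primroot p g"
begin

definition r :: nat where "r = p - 1"

lemma p_gt_1: "p > 1" using prime by (rule prime_gt_1_nat)

lemma r_pos: "r > 0" using p_gt_1 by (simp add: r_def)

definition \<omega> :: complex where "\<omega> = cis (2 * pi / real r)"

text \<open>The discrete logarithm to base \<open>g\<close>. Its value at multiples of
  \<open>p\<close> is arbitrary; \<open>char\<close> treats those separately.\<close>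

definition index :: "nat \<Rightarrow> nat" where
  "index n = inv_into {..<r} (\<lambda>i. g ^ i mod p) (n mod p)"

text \<open>The unit group is cyclic of order \<open>r\<close>, so \<open>k < r\<close> enumerates
  all Dirichlet characters modulo \<open>p\<close>; \<open>k = 0\<close> is the principal
  one.\<close>

definition char :: "nat \<Rightarrow> nat \<Rightarrow> complex" where
  "char k n = (if p dvd n then 0 else \<omega> ^ (k * index n))"

lemma bij_powers: "bij_betw (\<lambda>i. g ^ i mod p) {..<r} {1..<p}"
  using residue_primroot_is_generator[OF p_gt_1 primroot] prime
  by (simp add: totient_prime totatives_prime r_def atLeastSucLessThan_greaterThanLessThan)

lemma
  assumes "\<not> p dvd n"
  shows index_less: "index n < r" and power_index: "[g ^ index n = n] (mod p)"
proof -
  have "n mod p \<in> {1..<p}"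
    using assms p_gt_1 by (auto simp: Suc_le_eq mod_greater_zero_iff_not_dvd)
  then have *: "n mod p \<in> (\<lambda>i. g ^ i mod p) ` {..<r}"
    using bij_powers by (simp add: bij_betw_def)
  show "index n < r"
    using inv_into_into[OF *] by (simp add: index_def)
  show "[g ^ index n = n] (mod p)"
    using f_inv_into_f[OF *] by (simp add: index_def cong_def)
qed

lemma omega_power: "\<omega> ^ i = cis (2 * pi * real i / real r)"
  by (simp add: \<omega>_def DeMoivre mult_ac)

lemma omega_power_r: "\<omega> ^ r = 1"
  using r_pos by (simp add: omega_power)

lemma omega_power_cong:
  assumes "[i = j] (mod r)"
  shows "\<omega> ^ i = \<omega> ^ j"
proof -
  have "\<omega> ^ i = \<omega> ^ (i mod r)" for i
  proof -
    have "\<omega> ^ i = (\<omega> ^ r) ^ (i div r) * \<omega> ^ (i mod r)"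
      by (simp flip: power_mult power_add)
    then show ?thesis by (simp only: omega_power_r) simp
  qed
  then show ?thesis using assms by (metis cong_def)
qed

lemma inj_omega_power: "inj_on (\<lambda>i. \<omega> ^ i) {..<r}"
  using bij_betw_roots_unity[OF r_pos] by (simp add: omega_power bij_betw_def)

lemma norm_omega [simp]: "norm \<omega> = 1"
  by (simp add: \<omega>_def)

lemma omega_power_mult_cnj: "\<omega> ^ i * cnj \<omega> ^ i = 1"
proof -
  have "\<omega> * cnj \<omega> = 1"
    using complex_norm_square[of \<omega>] by simp
  then show ?thesis by (simp flip: power_mult_distrib)
qed

text \<open>Exponents of \<open>g\<close> matter only modulo its order \<open>r\<close>, and so do
  exponents of \<open>\<omega>\<close>; hence any exponent representing \<open>n\<close> may replace
  \<open>index n\<close>.\<close>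

lemma char_eq_omega_power:
  assumes "[n = g ^ i] (mod p)"
  shows "char k n = \<omega> ^ (k * i)"
proof -
  have g: "coprime p g" "ord p g = r"
    using primroot prime by (simp_all add: residue_primroot_def totient_prime r_def)
  have n: "\<not> p dvd n"
    using g(1) prime cong_dvd_iff[OF cong_sym[OF assms]] p_gt_1
    by (metis coprime_absorb_left cong_dvd_iff assms coprime_power_right_iff not_prime_unit prime_dvd_power)
  have "[g ^ index n = g ^ i] (mod p)"
    using power_index[OF n] assms by (rule cong_trans)
  then have "[index n = i] (mod r)"
    using order_divides_expdiff[OF g(1)] g(2) by simp
  then have "[k * index n = k * i] (mod r)"
    by (intro cong_mult) auto
  then show ?thesis
    using n omega_power_cong by (simp add: char_def)
qed

lemma char_cong: "[m = n] (mod p) \<Longrightarrow> char k m = char k n"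
  by (simp add: char_def index_def cong_def dvd_eq_mod_eq_0)

lemma char_mult: "char k (a * b) = char k a * char k b"
proof (cases "p dvd a * b")
  case False
  then have ab: "\<not> p dvd a" "\<not> p dvd b" by auto
  have "[a * b = g ^ index a * g ^ index b] (mod p)"
    by (intro cong_mult cong_sym[OF power_index] ab)
  then have "char k (a * b) = \<omega> ^ (k * (index a + index b))"
    by (intro char_eq_omega_power) (simp add: power_add)
  then show ?thesis
    using ab by (simp add: char_def algebra_simps power_add)
next
  case True
  then show ?thesis using prime by (auto simp: char_def prime_dvd_mult_iff)
qed

lemma char_one: "char k 1 = 1"
  using char_eq_omega_power[of 1 0 k] by simp

lemma norm_char_le: "norm (char k n) \<le> 1"
  by (simp add: char_def norm_power)

text \<open>Running through the nonzero residues as powers of \<open>g\<close> gives a geometric sum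
  of the \<open>r\<close>-th root of unity \<open>\<omega> ^ k\<close>, which is not 1.\<close>

lemma sum_char_eq_0:
  assumes k: "k \<in> {1..<r}"
  shows "(\<Sum>n<p. char k n) = 0"
proof -
  have "(\<Sum>n<p. char k n) = (\<Sum>n\<in>{1..<p}. char k n)"
    by (rule sum.mono_neutral_right) (auto simp: char_def Suc_le_eq)
  also have "\<dots> = (\<Sum>i<r. char k (g ^ i mod p))"
    by (rule sum.reindex_bij_betw[OF bij_powers, symmetric])
  also have "\<dots> = (\<Sum>i<r. (\<omega> ^ k) ^ i)"
    by (intro sum.cong refl) (simp add: char_eq_omega_power cong_def power_mult)
  also have "\<dots> = 0"
  proof (subst sum_powers_root_of_unity)
    show "(\<omega> ^ k) ^ r = 1"
      by (metis omega_power_r power_mult mult.commute power_one)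
    have "\<omega> ^ k \<noteq> \<omega> ^ 0"
      using inj_onD[OF inj_omega_power, of k 0] k r_pos by auto
    then show "(if \<omega> ^ k = 1 then complex_of_nat r else 0) = 0" by simp
  qed
  finally show ?thesis .
qed

lemma norm_sum_char_le:
  assumes k: "k \<in> {1..<r}"
  shows "norm (\<Sum>i<n. char k i) \<le> real p"
proof (induction n rule: less_induct)
  case (less n)
  show ?case
  proof (cases "n < p")
    case True
    have "norm (\<Sum>i<n. char k i) \<le> (\<Sum>i<n. 1)"
      by (intro sum_norm_le norm_char_le)
    then show ?thesis using True by simp
  next
    case False
    \<comment> \<open>A whole period sums to 0, so periods can be removed until fewer than
      \<open>p\<close> terms are left.\<close>
    have shift: "(\<Sum>i<p + m. char k i) = (\<Sum>i<m. char k i)" for m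
    proof (induction m)
      case (Suc m)
      have "char k (p + m) = char k m" by (rule char_cong) (simp add: cong_def)
      then show ?case using Suc by simp
    qed (use sum_char_eq_0[OF k] in simp)
    show ?thesis
      using shift[of "n - p"] less.IH[of "n - p"] False p_gt_1 by simp
  qed
qed

lemma bounded_character_char:
  assumes k: "k \<in> {1..<r}"
  shows "bounded_character (char k) (real p)"
proof
  fix n
  have "(\<Sum>i<Suc n. char k i) = (\<Sum>i=1..n. char k i)"
    by (rule sum.mono_neutral_right) (auto simp: char_def Suc_le_eq)
  then show "norm (\<Sum>i=1..n. char k i) \<le> real p"
    using norm_sum_char_le[OF k, of "Suc n"] by simp
qed (use char_mult char_one norm_char_le in auto)

section \<open>Orthogonality and the principal character\<close>

text \<open>For \<open>n\<close> prime to \<open>p\<close> the summand is \<open>z ^ k\<close>,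
  where \<open>z\<close> is \<open>\<omega>\<close> to the difference of the indices; the geometric
  sum detects \<open>z = 1\<close>, that is, equal indices.\<close>

lemma sum_char_orthogonal:
  assumes h: "\<not> p dvd h"
  shows "(\<Sum>k<r. cnj (char k h) * char k n) = (if [n = h] (mod p) then of_nat r else 0)"
proof (cases "p dvd n")
  case True
  then have "\<not> [n = h] (mod p)" using h cong_dvd_iff by blast
  then show ?thesis using True by (simp add: char_def)
next
  case False
  define z where "z = cnj (\<omega> ^ index h) * \<omega> ^ index n"
  have "(\<Sum>k<r. cnj (char k h) * char k n) = (\<Sum>k<r. z ^ k)"
    using h False by (simp add: char_def z_def power_mult_distrib mult.commute flip: power_mult)
  also have "z ^ r = (cnj (\<omega> ^ r)) ^ index h * (\<omega> ^ r) ^ index n"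
    by (simp add: z_def power_mult_distrib mult.commute flip: power_mult)
  then have "(\<Sum>k<r. z ^ k) = (if z = 1 then of_nat r else 0)"
    by (intro sum_powers_root_of_unity) (simp add: omega_power_r)
  also have "z = 1 \<longleftrightarrow> [n = h] (mod p)"
  proof
    assume "z = 1"
    have "\<omega> ^ index h * z = \<omega> ^ index n"
      by (simp only: z_def complex_cnj_power mult.assoc [symmetric] omega_power_mult_cnj) simp
    then have "index h = index n"
      using \<open>z = 1\<close> inj_onD[OF inj_omega_power] index_less h False by simp
    then show "[n = h] (mod p)"
      using power_index[OF h] power_index[OF False] by (metis cong_sym cong_trans)
  next
    assume "[n = h] (mod p)"
    then have "index n = index h" by (simp add: index_def cong_def)
    then show "z = 1"
      by (simp add: z_def mult.commute omega_power_mult_cnj)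
  qed
  finally show ?thesis .
qed

lemma sum_char_mangoldt:
  assumes h: "\<not> p dvd h"
  shows "(\<Sum>k<r. cnj (char k h) * mangoldt_partial_sum (char k) N)
    = of_real (real r * (\<Sum>n | n \<in> {1..N} \<and> [n = h] (mod p). mangoldt n / real n))"
proof -
  have "(\<Sum>k<r. cnj (char k h) * mangoldt_partial_sum (char k) N)
      = (\<Sum>k<r. \<Sum>n=1..N. cnj (char k h) * char k n * of_real (mangoldt n / real n))"
    by (simp add: mangoldt_partial_sum_def sum_distrib_left mult_ac)
  also have "\<dots> = (\<Sum>n=1..N. (\<Sum>k<r. cnj (char k h) * char k n) * of_real (mangoldt n / real n))"
    by (subst sum.swap) (simp only: sum_distrib_right)
  also have "\<dots> = (\<Sum>n=1..N. if [n = h] (mod p) then of_real (real r * (mangoldt n / real n)) else 0)"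
    by (intro sum.cong refl) (simp only: sum_char_orthogonal[OF h], simp)
  also have "\<dots> = (\<Sum>n | n \<in> {1..N} \<and> [n = h] (mod p). of_real (real r * (mangoldt n / real n)))"
    by (subst sum.inter_filter) auto
  finally show ?thesis by (simp only: of_real_sum sum_distrib_left)
qed

lemma mangoldt_partial_sum_char_0:
  "mangoldt_partial_sum (char 0) N = of_real (\<Sum>n | n \<in> {1..N} \<and> \<not> p dvd n. mangoldt n / real n)"
proof -
  have "mangoldt_partial_sum (char 0) N
      = (\<Sum>n=1..N. if \<not> p dvd n then of_real (mangoldt n / real n) else 0)"
    unfolding mangoldt_partial_sum_def by (intro sum.cong refl) (auto simp: char_def)
  also have "\<dots> = (\<Sum>n | n \<in> {1..N} \<and> \<not> p dvd n. of_real (mangoldt n / real n))"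
    by (subst sum.inter_filter) auto
  finally show ?thesis by (simp only: of_real_sum)
qed

lemma Re_principal_le:
  assumes "N > 0"
  shows "Re (mangoldt_partial_sum (char 0) N) \<le> ln (real N) + 4"
proof -
  have "(\<Sum>n | n \<in> {1..N} \<and> \<not> p dvd n. mangoldt n / real n) \<le> (\<Sum>n=1..N. mangoldt n / real n)"
    by (rule sum_mono2) (auto simp: mangoldt_nonneg)
  then show ?thesis
    using sum_mangoldt_over_le[of N] assms unfolding mangoldt_partial_sum_char_0 Re_complex_of_real by linarith
qed

text \<open>The terms missing from the full Mertens sum are multiples of \<open>p\<close>; each is
  \<open>p\<close> itself or not prime, so their total is bounded.\<close>

lemma Re_principal_ge: "\<exists>C. \<forall>N>0. Re (mangoldt_partial_sum (char 0) N) \<ge> ln (real N) - C"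
proof -
  obtain C where C: "\<And>N. (\<Sum>d | d \<in> {1..N} \<and> \<not> prime d. mangoldt d / real d) \<le> C"
    using sum_mangoldt_nonprime_bounded by blast
  have "Re (mangoldt_partial_sum (char 0) N) \<ge> ln (real N) - (1 + mangoldt p / real p + C)"
    if N: "N > 0" for N
  proof -
    have "(\<Sum>n=1..N. mangoldt n / real n)
        = (\<Sum>n | n \<in> {1..N} \<and> \<not> p dvd n. mangoldt n / real n)
          + (\<Sum>n | n \<in> {1..N} \<and> p dvd n. mangoldt n / real n)"
      by (subst sum.union_disjoint [symmetric]) (auto intro!: sum.cong)
    moreover have "(\<Sum>n | n \<in> {1..N} \<and> p dvd n. mangoldt n / real n)
        \<le> (\<Sum>n\<in>insert p {d \<in> {1..N}. \<not> prime d}. mangoldt n / real n)"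
      using prime by (intro sum_mono2) (auto simp: mangoldt_nonneg dest: primes_dvd_imp_eq)
    moreover have "\<dots> = mangoldt p / real p + (\<Sum>d | d \<in> {1..N} \<and> \<not> prime d. mangoldt d / real d)"
      using prime by (subst sum.insert) auto
    ultimately show ?thesis
      using C[of N] sum_mangoldt_over_ge[of N] N
      unfolding mangoldt_partial_sum_char_0 Re_complex_of_real by linarith
  qed
  then show ?thesis by blast
qed

section \<open>Nonvanishing of L at 1 for every nonprincipal character\<close>

lemma char_complement:
  assumes "k \<le> r"
  shows "char (r - k) n = cnj (char k n)"
proof (cases "p dvd n")
  case False
  let ?i = "index n"
  have "\<omega> ^ ((r - k) * ?i) * \<omega> ^ (k * ?i) = (\<omega> ^ r) ^ ?i"
    using assms by (simp flip: power_add power_mult add: distrib_right [symmetric])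
  moreover have "cnj (\<omega> ^ (k * ?i)) * \<omega> ^ (k * ?i) = 1"
    by (simp add: mult.commute omega_power_mult_cnj)
  moreover have "\<omega> ^ (k * ?i) \<noteq> 0"
    by (metis norm_omega norm_zero power_not_zero zero_neq_one)
  ultimately have "\<omega> ^ ((r - k) * ?i) = cnj (\<omega> ^ (k * ?i))"
    by (metis mult_right_cancel omega_power_r power_one)
  then show ?thesis using False by (simp add: char_def)
qed (simp add: char_def)

lemma L_complement:
  assumes "k \<in> {1..<r}"
  shows "L_at_1 (char (r - k)) = cnj (L_at_1 (char k))"
proof (rule LIMSEQ_unique)
  show "harmonic_partial_sum (char (r - k)) \<longlonglongrightarrow> L_at_1 (char (r - k))"
    using assms by (intro bounded_character.A_tendsto[OF bounded_character_char]) auto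
  have "harmonic_partial_sum (char (r - k)) = (\<lambda>N. cnj (harmonic_partial_sum (char k) N))"
    using assms by (simp add: harmonic_partial_sum_def fun_eq_iff char_complement)
  then show "harmonic_partial_sum (char (r - k)) \<longlonglongrightarrow> cnj (L_at_1 (char k))"
    using bounded_character.A_tendsto[OF bounded_character_char[OF assms]]
    by (simp add: lim_cnj)
qed

text \<open>If \<open>2 * k = r\<close>, the character is real. Otherwise the conjugate character
  \<open>char (r - k)\<close> is a second one with \<open>L = 0\<close>, and two zeros outweigh the
  growth of the principal character.\<close>

lemma L_nonzero:
  assumes k: "k \<in> {1..<r}"
  shows "L_at_1 (char k) \<noteq> 0"
proof (cases "2 * k = r")
  case True
  have "(\<omega> ^ k)\<^sup>2 = 1"
    using omega_power_r True by (simp flip: power_mult add: mult.commute)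
  then have "\<omega> ^ k = 1 \<or> \<omega> ^ k = -1"
    by (simp add: power2_eq_1_iff)
  then have "char k n \<in> {-1, 0, 1}" for n
    by (cases "even (index n)") (auto simp: char_def power_mult)
  then interpret real_character "char k" "real p"
    using bounded_character_char[OF k] by (simp add: real_character_def real_character_axioms_def)
  show ?thesis by (rule L_nonzero)
next
  case False
  show ?thesis
  proof
    assume L: "L_at_1 (char k) = 0"
    define k' where "k' = r - k"
    have k': "k' \<in> {1..<r}" "k' \<noteq> k" "L_at_1 (char k') = 0"
      using k False L L_complement[OF k] by (auto simp: k'_def)
    have "\<forall>j\<in>{1..<r}. \<exists>C. \<forall>N>0. Re (mangoldt_partial_sum (char j) N) \<le> C"
      using bounded_character.Re_S_bounded_above[OF bounded_character_char] by blast
    then obtain C where C: "\<And>j N. j \<in> {1..<r} \<Longrightarrow> N > 0 \<Longrightarrow> Re (mangoldt_partial_sum (char j) N) \<le> C j"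
      by metis
    have zero: "Re (mangoldt_partial_sum (char j) N) \<le> 2 * real p - ln (real N)"
      if j: "j \<in> {1..<r}" "L_at_1 (char j) = 0" and N: "N > 0" for j N
    proof -
      have "Re (of_real (ln (real N)) + mangoldt_partial_sum (char j) N) \<le> 2 * real p"
        using bounded_character.S_asymptotics_if_L_zero[OF bounded_character_char[OF j(1)] j(2) N]
          complex_Re_le_cmod order_trans by blast
      then show ?thesis by simp
    qed
    show False
    proof (rule not_ln_bounded)
      fix N :: nat assume N: "N > 0"
      \<comment> \<open>At the residue class of 1 every character has value 1, so the plain sum over
        all characters is nonnegative.\<close>
      have "0 \<le> real r * (\<Sum>n | n \<in> {1..N} \<and> [n = 1] (mod p). mangoldt n / real n)"
        by (intro mult_nonneg_nonneg sum_nonneg) (auto simp: mangoldt_nonneg)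
      also have "\<dots> = Re (\<Sum>j<r. cnj (char j 1) * mangoldt_partial_sum (char j) N)"
        using p_gt_1 by (subst sum_char_mangoldt) auto
      also have "\<dots> = (\<Sum>j<r. Re (mangoldt_partial_sum (char j) N))"
        by (simp add: char_one[simplified])
      also have "{..<r} = insert 0 (insert k (insert k' ({1..<r} - {k, k'})))"
        using k k' by auto
      also have "(\<Sum>j\<in>\<dots>. Re (mangoldt_partial_sum (char j) N))
          = Re (mangoldt_partial_sum (char 0) N) + (Re (mangoldt_partial_sum (char k) N)
            + (Re (mangoldt_partial_sum (char k') N)
            + (\<Sum>j\<in>{1..<r} - {k, k'}. Re (mangoldt_partial_sum (char j) N))))"
        using k k' by (subst sum.insert; (subst sum.insert)?; (subst sum.insert)?) auto
      \<comment> \<open>One \<open>ln N\<close> from the principal character against two with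
        negative sign leaves \<open>- ln N\<close> plus a constant, which cannot stay
        nonnegative.\<close>
      also have "\<dots> \<le> (ln (real N) + 4) + ((2 * real p - ln (real N)) + ((2 * real p - ln (real N))
          + (\<Sum>j\<in>{1..<r} - {k, k'}. C j)))"
        using N k k' L by (intro add_mono Re_principal_le zero sum_mono C) auto
      finally show "ln (real N) \<le> 4 + 4 * real p + (\<Sum>j\<in>{1..<r} - {k, k'}. C j)"
        by simp
    qed
  qed
qed

section \<open>Divergence over residue classes and infinitely many primes\<close>

text \<open>By orthogonality the class sum combines all characters; the nonprincipal ones stay
  bounded because their \<open>L\<close> is nonzero, and the principal one supplies
  \<open>ln N\<close>.\<close>

lemma sum_mangoldt_residue_class_ge:
  assumes h: "\<not> p dvd h"
  shows "\<exists>C. \<forall>N>0. ln (real N) - C \<le> real r * (\<Sum>n | n \<in> {1..N} \<and> [n = h] (mod p). mangoldt n / real n)"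
proof -
  have "\<forall>j\<in>{1..<r}. \<exists>C. \<forall>N. norm (mangoldt_partial_sum (char j) N) \<le> C"
    using bounded_character.S_bounded_if_L_nonzero[OF bounded_character_char L_nonzero] by blast
  then obtain C where C: "\<And>j N. j \<in> {1..<r} \<Longrightarrow> norm (mangoldt_partial_sum (char j) N) \<le> C j"
    by metis
  obtain D where D: "\<And>N. N > 0 \<Longrightarrow> Re (mangoldt_partial_sum (char 0) N) \<ge> ln (real N) - D"
    using Re_principal_ge by blast
  have "ln (real N) - (D + (\<Sum>j\<in>{1..<r}. C j))
      \<le> real r * (\<Sum>n | n \<in> {1..N} \<and> [n = h] (mod p). mangoldt n / real n)" if N: "N > 0" for N
  proof -
    let ?S = "\<lambda>j. mangoldt_partial_sum (char j) N"
    have "norm (\<Sum>j\<in>{1..<r}. cnj (char j h) * ?S j) \<le> (\<Sum>j\<in>{1..<r}. 1 * C j)"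
    proof (rule sum_norm_le)
      fix j assume "j \<in> {1..<r}"
      then show "norm (cnj (char j h) * ?S j) \<le> 1 * C j"
        unfolding norm_mult complex_mod_cnj by (intro mult_mono norm_char_le C) auto
    qed
    then have "- (\<Sum>j\<in>{1..<r}. C j) \<le> Re (\<Sum>j\<in>{1..<r}. cnj (char j h) * ?S j)"
      using abs_Re_le_cmod[of "\<Sum>j\<in>{1..<r}. cnj (char j h) * ?S j"] by simp
    moreover have "{..<r} = insert 0 {1..<r}"
      using r_pos by auto
    then have "(\<Sum>j<r. cnj (char j h) * ?S j) = ?S 0 + (\<Sum>j\<in>{1..<r}. cnj (char j h) * ?S j)"
      using h by (simp add: char_def)
    then have "Re (\<Sum>j<r. cnj (char j h) * ?S j) = Re (?S 0) + Re (\<Sum>j\<in>{1..<r}. cnj (char j h) * ?S j)"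
      by (simp only: plus_complex.sel)
    moreover have "Re (\<Sum>j<r. cnj (char j h) * ?S j)
        = real r * (\<Sum>n | n \<in> {1..N} \<and> [n = h] (mod p). mangoldt n / real n)"
      unfolding sum_char_mangoldt[OF h] by simp
    ultimately show ?thesis using D[OF N] by linarith
  qed
  then show ?thesis by blast
qed

text \<open>Finitely many primes in the class, together with the bounded contribution of all
  nonprimes, would bound \<open>ln N\<close>.\<close>

lemma infinite_primes_in_residue_class:
  assumes h: "\<not> p dvd h"
  shows "infinite {q. prime q \<and> [q = h] (mod p)}" (is "infinite ?Q")
proof
  assume fin: "finite ?Q"
  obtain C where C: "\<And>N. (\<Sum>d | d \<in> {1..N} \<and> \<not> prime d. mangoldt d / real d) \<le> C"
    using sum_mangoldt_nonprime_bounded by blast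
  obtain D where D: "\<And>N. N > 0 \<Longrightarrow>
      ln (real N) - D \<le> real r * (\<Sum>n | n \<in> {1..N} \<and> [n = h] (mod p). mangoldt n / real n)"
    using sum_mangoldt_residue_class_ge[OF h] by blast
  show False
  proof (rule not_ln_bounded)
    fix N :: nat assume N: "N > 0"
    have "(\<Sum>n | n \<in> {1..N} \<and> [n = h] (mod p). mangoldt n / real n)
        \<le> (\<Sum>n\<in>?Q \<union> {d \<in> {1..N}. \<not> prime d}. mangoldt n / real n)"
      using fin by (intro sum_mono2) (auto simp: mangoldt_nonneg)
    also have "\<dots> = (\<Sum>q\<in>?Q. mangoldt q / real q) + (\<Sum>d | d \<in> {1..N} \<and> \<not> prime d. mangoldt d / real d)"
      using fin by (subst sum.union_disjoint) auto
    also have "\<dots> \<le> (\<Sum>q\<in>?Q. mangoldt q / real q) + C"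
      using C by simp
    finally have "real r * (\<Sum>n | n \<in> {1..N} \<and> [n = h] (mod p). mangoldt n / real n)
        \<le> real r * ((\<Sum>q\<in>?Q. mangoldt q / real q) + C)"
      by (rule mult_left_mono) simp
    then show "ln (real N) \<le> D + real r * ((\<Sum>q\<in>?Q. mangoldt q / real q) + C)"
      using D[OF N] by linarith
  qed
qed

end

section \<open>Transfer to integer progressions\<close>

theorem theorem2p2:
  fixes p :: int
  assumes "prime p"
  shows "\<forall>h::int. h > 0 \<and> gcd h p = 1 \<longrightarrow> infinite {q \<in> arith_prog h p. prime q}"
proof (intro allI impI)
  fix h :: int assume h: "h > 0 \<and> gcd h p = 1"
  define P H where "P = nat p" and "H = nat h"
  have PH: "p = int P" "h = int H"
    using prime_gt_0_int[OF assms] h by (auto simp: P_def H_def)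
  have "prime P"
    using assms unfolding PH(1) by simp
  obtain g where "residue_primroot P g"
    using prime_primitive_root_exists[of P] \<open>prime P\<close> prime_gt_1_nat by blast
  with \<open>prime P\<close> interpret prime_primroot P g by unfold_locales
  have "gcd H P = 1"
    using h unfolding PH by simp
  then have "coprime H P"
    by (simp only: coprime_iff_gcd_eq_1)
  then have "\<not> P dvd H"
    using \<open>prime P\<close> by (metis coprime_absorb_right coprime_commute not_prime_unit)
  \<comment> \<open>The progression starts at \<open>h\<close>, so congruent primes below
    \<open>H\<close> are discarded; for the others \<open>q - H\<close> is a true difference of
    naturals and a multiple of \<open>P\<close>.\<close>
  then have "infinite ({q. prime q \<and> [q = H] (mod P)} - {..<H})"
    by (intro Diff_infinite_finite infinite_primes_in_residue_class) auto
  then have "infinite (int ` ({q. prime q \<and> [q = H] (mod P)} - {..<H}))"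
    by (simp add: finite_image_iff)
  moreover have "int ` ({q. prime q \<and> [q = H] (mod P)} - {..<H}) \<subseteq> {q \<in> arith_prog h p. prime q}"
  proof (clarsimp simp: arith_prog_def)
    fix q assume q: "prime q" "[q = H] (mod P)" "\<not> q < H"
    then have "P dvd q - H"
      by (simp add: cong_altdef_nat)
    then obtain m where "q - H = P * m" ..
    with q(3) have "q = P * m + H" by simp
    then have "int q = p * int m + h" by (simp add: PH)
    then show "\<exists>m. int q = p * int m + h" ..
  qed
  ultimately show "infinite {q \<in> arith_prog h p. prime q}"
    using finite_subset by blast
qed

end
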